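(* Let $T>0$ and let $z_1,z_2\in C([0,T];\mathscr H)$ with $z_i(0,\cdot)\le0$. Let $(w_1,\eta_1)$ and $(w_2,\eta_2)$ be the solutions of the heat equation with obstacle $z_1$, respectively $z_2$. Then $w_1,w_2\in C([0,T];\mathscr H)$ and $$\|w_1-w_2\|_{\mathscr H,T}\le\|z_1-z_2\|_{\mathscr H,T}.$$
   Context: $\mathscr H=\{f\in C([0,1]): f(0)=f(1)=0,\ f'(0)\text{ exists}\}$ with norm $\|f\|_{\mathscr H}=\sup_{x\in(0,1]}|f(x)/x|$, and $\|v\|_{\mathscr H,T}=\sup_{t\in[0,T]}\|v(t,\cdot)\|_{\mathscr H}$. Given $z\in C([0,T]\times[0,1])$ with $z(t,\cdot)$ continuous vanishing at $0,1$ for each $t$ and $z(0,\cdot)\le0$, a pair $(w,\eta)$ solves the heat equation with obstacle $z$ if: $w\in C([0,T]\times[0,1])$, $w(t,0)=w(t,1)=0$, $w(0,\cdot)\equiv0$, $w\ge z$; $\eta$ is a measure on $(0,1)\times[0,T]$; for every $t\in[0,T]$ and every $\phi\in C^2((0,1))$ continuous on $[0,1]$ vanishing at $0,1$, $\int_0^1w(t,x)\phi(x)dx=\int_0^t\int_0^1w(s,x)\phi''(x)dxds+\int_0^t\int_0^1\phi(x)\eta(dx,ds)$; and $\int_0^t\int_0^1(w-z)\,d\eta=0$. Such a solution exists and is unique. *)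

theory Defs
  imports "HOL-Analysis.Analysis"
begin

definition in_H :: "(real \<Rightarrow> real) \<Rightarrow> bool" where
  "in_H f \<longleftrightarrow> continuous_on {0..1} f \<and> f 0 = 0 \<and> f 1 = 0 \<and>
     f differentiable (at 0 within {0..1})"

definition H_norm :: "(real \<Rightarrow> real) \<Rightarrow> real" where
  "H_norm f = (SUP x\<in>{0<..1}. \<bar>f x / x\<bar>)"

definition H_normT :: "real \<Rightarrow> (real \<Rightarrow> real \<Rightarrow> real) \<Rightarrow> real" where
  "H_normT T v = (SUP t\<in>{0..T}. H_norm (v t))"

definition C_H :: "real \<Rightarrow> (real \<Rightarrow> real \<Rightarrow> real) \<Rightarrow> bool" where
  "C_H T v \<longleftrightarrow> (\<forall>t\<in>{0..T}. in_H (v t)) \<and>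
     (\<forall>t\<in>{0..T}. ((\<lambda>s. H_norm (\<lambda>x. v s x - v t x)) \<longlongrightarrow> 0) (at t within {0..T}))"

definition test_fun :: "(real \<Rightarrow> real) \<Rightarrow> (real \<Rightarrow> real) \<Rightarrow> (real \<Rightarrow> real) \<Rightarrow> bool" where
  "test_fun \<phi> \<phi>' \<phi>'' \<longleftrightarrow>
     (\<forall>x\<in>{0<..<1}. (\<phi> has_real_derivative \<phi>' x) (at x) \<and> (\<phi>' has_real_derivative \<phi>'' x) (at x)) \<and>
     continuous_on {0<..<1} \<phi>'' \<and> continuous_on {0..1} \<phi> \<and> \<phi> 0 = 0 \<and> \<phi> 1 = 0"

definition obstacle_sol ::
  "real \<Rightarrow> (real \<Rightarrow> real \<Rightarrow> real) \<Rightarrow> (real \<Rightarrow> real \<Rightarrow> real) \<Rightarrow> (real \<times> real) measure \<Rightarrow> bool" where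
  "obstacle_sol T z w \<eta> \<longleftrightarrow>
     continuous_on ({0..T} \<times> {0..1}) (\<lambda>(t,x). w t x) \<and>
     (\<forall>t\<in>{0..T}. w t 0 = 0 \<and> w t 1 = 0) \<and>
     (\<forall>x\<in>{0..1}. w 0 x = 0) \<and>
     (\<forall>t\<in>{0..T}. \<forall>x\<in>{0..1}. z t x \<le> w t x) \<and>
     sets \<eta> = sets borel \<and>
     emeasure \<eta> (UNIV - {0<..<1} \<times> {0..T}) = 0 \<and>
     (\<forall>a b. 0 < a \<longrightarrow> b < 1 \<longrightarrow> emeasure \<eta> ({a..b} \<times> {0..T}) < \<infinity>) \<and>
     (\<forall>t\<in>{0..T}. \<forall>\<phi> \<phi>' \<phi>''. test_fun \<phi> \<phi>' \<phi>'' \<longrightarrow>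
        set_integrable lborel ({0..t} \<times> {0..1}) (\<lambda>(s,x). w s x * \<phi>'' x) \<longrightarrow>
        set_integrable \<eta> ({0<..<1} \<times> {0..t}) (\<lambda>(x,s). \<phi> x) \<longrightarrow>
        integral {0..1} (\<lambda>x. w t x * \<phi> x) =
          (LINT p : {0..t} \<times> {0..1} | lborel. (case p of (s,x) \<Rightarrow> w s x * \<phi>'' x)) +
          (LINT p : {0<..<1} \<times> {0..t} | \<eta>. (case p of (x,s) \<Rightarrow> \<phi> x))) \<and>
     (\<forall>t\<in>{0..T}. (\<integral>\<^sup>+ p. ennreal (case p of (x,s) \<Rightarrow> w s x - z s x)
                        * indicator ({0<..<1} \<times> {0..t}) p \<partial>\<eta>) = 0)"

end

theory Submission
  imports Defs
begin

text \<open>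
  Both assertions rest on a comparison principle. Where $w_1 - w_2 > Cx$ and $z_1 \le z_2 + Cx$, the
  first solution stays off its obstacle, so $\eta_1$ vanishes there and $w_1 - w_2$ is a weak
  subsolution of the heat equation; since $Cx$ is a steady state, a maximum principle for
  continuous weak subsolutions gives $w_1 - w_2 \le Cx$. Mollifying in space alone suffices for it,
  as the weak formulation already controls time increments.

  Comparing $w$ with its own time shifts and with the zero solution shows that
  $|w(s,x) - w(t,x)| \le \epsilon x$ for $|s - t|$ small. For the derivative at $x = 0$, put
  $A(x) = \int_a^t w(s,x)\,ds$: because $\eta \ge 0$, $A''$ is bounded above by a constant $K$ in
  the weak sense, so $A - Kx^2/2$ is concave and its quotient by $x$ is decreasing. As
  $A(x)/((t-a)x)$ is uniformly close to $w(t,x)/x$ for $a$ near $t$, the latter converges as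
  $x \to 0$.
\<close>

section \<open>Mollification in space\<close>

text \<open>Two features of the data shape the argument. The measure \<eta> has finite mass only on
  strips \<open>{a..b} \<times> {0..T}\<close> with 0 < a and b < 1, so the equation is tested only
  with kernels supported in the open interval; what happens near x = 0 and x = 1 is left to boundary
  values and uniform continuity. Moreover w is merely continuous in time, so no time derivative is
  available at a maximum point. Testing with a kernel in x leaves an identity for w(t2) - w(t1), and
  a short step back in time from the maximum does the work of the derivative; a penalty \<epsilon> t
  makes the resulting inequality strict. The mollification width stays fixed in the maximum
  principle, since a positive excess of w1 - w2 over Cx leaves room for a small mollification error.
  It tends to 0 only where concavity of a time integral is inferred.\<close>

lemma has_real_derivative_max_0_power:
  fixes u :: real
  shows "((\<lambda>u. max 0 u ^ Suc (Suc n)) has_real_derivative real (Suc (Suc n)) * max 0 u ^ Suc n) (at u)"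
proof -
  consider "u > 0" | "u < 0" | "u = 0" by linarith
  then show ?thesis
  proof cases
    case 1
    have "((\<lambda>u. u ^ Suc (Suc n)) has_real_derivative real (Suc (Suc n)) * u ^ Suc n) (at u)"
      by (rule derivative_eq_intros refl | simp)+
    then have "((\<lambda>u. max 0 u ^ Suc (Suc n)) has_real_derivative real (Suc (Suc n)) * u ^ Suc n) (at u)"
      by (rule has_field_derivative_transform_within_open[where S = "{0<..}"]) (use 1 in auto)
    then show ?thesis using 1 by simp
  next
    case 2
    have "((\<lambda>u. 0) has_real_derivative 0) (at u)" by simp
    then have "((\<lambda>u. max 0 u ^ Suc (Suc n)) has_real_derivative 0) (at u)"
      by (rule has_field_derivative_transform_within_open[where S = "{..<0}"]) (use 2 in auto)
    then show ?thesis using 2 by simp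
  next
    case 3
    have "((\<lambda>h::real. max 0 h ^ Suc (Suc n) / h) \<longlongrightarrow> 0) (at 0)"
    proof (rule Lim_null_comparison)
      show "\<forall>\<^sub>F h in at (0::real). norm (max 0 h ^ Suc (Suc n) / h) \<le> \<bar>h\<bar> ^ Suc n"
      proof (intro always_eventually allI)
        fix h :: real
        show "norm (max 0 h ^ Suc (Suc n) / h) \<le> \<bar>h\<bar> ^ Suc n" 
        proof (cases "h > 0")
          case False
          then have "max 0 h = 0" by simp
          then have "norm (max 0 h ^ Suc (Suc n) / h) = 0" by simp
          then show ?thesis using zero_le_power[OF abs_ge_zero] by (simp only:)
        qed auto
      qed
      have "((\<lambda>h::real. \<bar>h\<bar> ^ Suc n) \<longlongrightarrow> \<bar>0\<bar> ^ Suc n) (at 0)"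
        by (intro tendsto_intros)
      then show "((\<lambda>h::real. \<bar>h\<bar> ^ Suc n) \<longlongrightarrow> 0) (at 0)" by simp
    qed
    then show ?thesis using 3 by (simp add: DERIV_def)
  qed
qed

text \<open>The cube is the least integer power of the truncated parabola with a continuous second
  derivative, as \<open>test_fun\<close> requires, and a polynomial on the support keeps derivatives
  and mass explicit. The integral of (\<delta>^2 - x^2)^3 over [-\<delta>, \<delta>] is 32
  \<delta>^7 / 35, whence the factor.\<close>

definition bump :: "real \<Rightarrow> real \<Rightarrow> real" where
  "bump \<delta> x = 35 / (32 * \<delta> ^ 7) * max 0 (\<delta>\<^sup>2 - x\<^sup>2) ^ 3"

definition bump' :: "real \<Rightarrow> real \<Rightarrow> real" where
  "bump' \<delta> x = 35 / (32 * \<delta> ^ 7) * (- 6 * x * max 0 (\<delta>\<^sup>2 - x\<^sup>2) ^ 2)"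

definition bump'' :: "real \<Rightarrow> real \<Rightarrow> real" where
  "bump'' \<delta> x = 35 / (32 * \<delta> ^ 7) *
     (24 * x\<^sup>2 * max 0 (\<delta>\<^sup>2 - x\<^sup>2) - 6 * max 0 (\<delta>\<^sup>2 - x\<^sup>2) ^ 2)"

lemma bump_deriv: "(bump \<delta> has_real_derivative bump' \<delta> x) (at x)"
proof -
  have inner: "((\<lambda>x. \<delta>\<^sup>2 - x\<^sup>2) has_real_derivative - 2 * x) (at x)"
    by (rule derivative_eq_intros refl | simp)+
  have "((\<lambda>x. max 0 (\<delta>\<^sup>2 - x\<^sup>2) ^ 3) has_real_derivative
      3 * max 0 (\<delta>\<^sup>2 - x\<^sup>2) ^ 2 * (- 2 * x)) (at x)"
    using DERIV_chain2[where g = "\<lambda>x. \<delta>\<^sup>2 - x\<^sup>2", OF has_real_derivative_max_0_power[where n = 1] inner]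
    by (simp add: eval_nat_numeral)
  from DERIV_cmult[OF this, of "35 / (32 * \<delta> ^ 7)"] show ?thesis
    unfolding bump_def bump'_def by (simp add: algebra_simps)
qed

lemma bump'_deriv: "(bump' \<delta> has_real_derivative bump'' \<delta> x) (at x)"
proof -
  have inner: "((\<lambda>x. \<delta>\<^sup>2 - x\<^sup>2) has_real_derivative - 2 * x) (at x)"
    by (rule derivative_eq_intros refl | simp)+
  have sq: "((\<lambda>x. max 0 (\<delta>\<^sup>2 - x\<^sup>2) ^ 2) has_real_derivative
      2 * max 0 (\<delta>\<^sup>2 - x\<^sup>2) * (- 2 * x)) (at x)"
    using DERIV_chain2[where g = "\<lambda>x. \<delta>\<^sup>2 - x\<^sup>2", OF has_real_derivative_max_0_power[where n = 0] inner]
    by (simp add: eval_nat_numeral)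
  have "((\<lambda>x. - 6 * x * max 0 (\<delta>\<^sup>2 - x\<^sup>2) ^ 2) has_real_derivative
      24 * x\<^sup>2 * max 0 (\<delta>\<^sup>2 - x\<^sup>2) - 6 * max 0 (\<delta>\<^sup>2 - x\<^sup>2) ^ 2) (at x)"
    by (rule derivative_eq_intros sq refl)+ (simp add: power2_eq_square algebra_simps)
  from DERIV_cmult[OF this, of "35 / (32 * \<delta> ^ 7)"] show ?thesis
    unfolding bump'_def[abs_def] bump''_def by simp
qed

lemma continuous_on_bump [continuous_intros]:
  assumes "continuous_on S f" shows "continuous_on S (\<lambda>x. bump \<delta> (f x))"
  unfolding bump_def divide_inverse by (intro continuous_intros assms)

lemma continuous_on_bump' [continuous_intros]:
  assumes "continuous_on S f" shows "continuous_on S (\<lambda>x. bump' \<delta> (f x))"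
  unfolding bump'_def divide_inverse by (intro continuous_intros assms)

lemma continuous_on_bump'' [continuous_intros]:
  assumes "continuous_on S f" shows "continuous_on S (\<lambda>x. bump'' \<delta> (f x))"
  unfolding bump''_def divide_inverse by (intro continuous_intros assms)

lemma bump_nonneg: "\<delta> > 0 \<Longrightarrow> bump \<delta> x \<ge> 0"
  by (simp add: bump_def)

lemma bump_eq_0:
  assumes "\<delta> > 0" "\<delta> \<le> \<bar>x\<bar>" shows "bump \<delta> x = 0"
proof -
  have "\<delta>\<^sup>2 \<le> x\<^sup>2" using assms by (metis abs_le_square_iff abs_of_pos)
  then show ?thesis by (simp add: bump_def)
qed

lemma integral_bump:
  assumes "\<delta> > 0" "\<delta> \<le> y" "y \<le> 1 - \<delta>"
  shows "integral {0..1} (\<lambda>x. bump \<delta> (x - y)) = 1"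
proof -
  \<comment> \<open>Termwise antiderivative of the expanded cube. It matches
    \<open>bump \<delta>\<close> only on the support, so the integral is computed over
    \<open>{y - \<delta>..y + \<delta>}\<close> and then extended by zero to the unit
    interval.\<close>
  define P where "P x = 35 / (32 * \<delta> ^ 7) * (\<delta>^6 * x - \<delta>^4 * x^3 + 3 / 5 * \<delta>^2 * x^5 - x^7 / 7)" for x :: real
  have D: "(P has_real_derivative bump \<delta> x) (at x)" if "x \<in> {-\<delta>..\<delta>}" for x
  proof -
    have "x\<^sup>2 \<le> \<delta>\<^sup>2" using that by (metis abs_le_iff abs_le_square_iff abs_of_pos assms(1) atLeastAtMost_iff minus_le_iff)
    then have "bump \<delta> x = 35 / (32 * \<delta> ^ 7) * (\<delta>\<^sup>2 - x\<^sup>2) ^ 3" by (simp add: bump_def)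
    moreover have "(P has_real_derivative 35 / (32 * \<delta> ^ 7) * (\<delta>\<^sup>2 - x\<^sup>2) ^ 3) (at x)"
      unfolding P_def by (rule derivative_eq_intros refl | simp)+ algebra
    ultimately show ?thesis by simp
  qed
  have "((\<lambda>x. bump \<delta> (x - y)) has_integral (P (y + \<delta> - y) - P (y - \<delta> - y))) {y - \<delta>..y + \<delta>}"
  proof (rule fundamental_theorem_of_calculus)
    show "y - \<delta> \<le> y + \<delta>" using assms by simp
    fix x assume x: "x \<in> {y - \<delta>..y + \<delta>}"
    have "((\<lambda>x. P (x - y)) has_real_derivative bump \<delta> (x - y) * 1) (at x)"
      by (rule DERIV_chain2[OF D]) (use x in \<open>auto intro!: derivative_eq_intros\<close>)
    then show "((\<lambda>x. P (x - y)) has_vector_derivative bump \<delta> (x - y)) (at x within {y - \<delta>..y + \<delta>})"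
      by (simp add: has_real_derivative_iff_has_vector_derivative has_vector_derivative_at_within)
  qed
  moreover have "P \<delta> - P (-\<delta>) = 1"
    using assms unfolding P_def by (simp add: field_simps power_numeral_reduce)
  ultimately have "((\<lambda>x. bump \<delta> (x - y)) has_integral 1) {y - \<delta>..y + \<delta>}" by simp
  then have "((\<lambda>x. bump \<delta> (x - y)) has_integral 1) {0..1}"
    by (rule has_integral_on_superset) (use assms in \<open>auto intro!: bump_eq_0\<close>)
  then show ?thesis by (rule integral_unique)
qed

lemma test_fun_bump:
  assumes "\<delta> > 0" "\<delta> < y" "y < 1 - \<delta>"
  shows "test_fun (\<lambda>x. bump \<delta> (x - y)) (\<lambda>x. bump' \<delta> (x - y)) (\<lambda>x. bump'' \<delta> (x - y))"
  unfolding test_fun_def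
proof (intro conjI ballI)
  fix x :: real
  have *: "((\<lambda>x. x - y) has_real_derivative 1) (at x)" by (auto intro!: derivative_eq_intros)
  show "((\<lambda>x. bump \<delta> (x - y)) has_real_derivative bump' \<delta> (x - y)) (at x)"
    using DERIV_chain2[OF bump_deriv *] by simp
  show "((\<lambda>x. bump' \<delta> (x - y)) has_real_derivative bump'' \<delta> (x - y)) (at x)"
    using DERIV_chain2[OF bump'_deriv *] by simp
qed (use assms in \<open>auto intro!: continuous_intros bump_eq_0\<close>)

lemma continuous_on_integral_bump'':
  fixes v :: "real \<Rightarrow> real \<Rightarrow> real"
  assumes "continuous_on ({a..b} \<times> {0..1}) (\<lambda>(t,x). v t x)"
  shows "continuous_on {a..b} (\<lambda>s. integral {0..1} (\<lambda>x. v s x * bump'' \<delta> (x - y)))"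
proof -
  have "continuous_on ({a..b} \<times> cbox 0 1) (\<lambda>(s,x). v s x * bump'' \<delta> (x - y))"
    using assms by (auto simp: case_prod_beta intro!: continuous_intros)
  then show ?thesis using integral_continuous_on_param by fastforce
qed

section \<open>Convolution of a continuous function with the kernel\<close>

context
  fixes g :: "real \<Rightarrow> real" and \<delta> :: real
  assumes g: "continuous_on {0..1} g"
begin

lemma integrable_bump: "(\<lambda>x. g x * bump \<delta> (x - y)) integrable_on {0..1}"
  by (intro integrable_continuous_interval continuous_intros g)

lemma integrable_bump': "(\<lambda>x. g x * bump' \<delta> (x - y)) integrable_on {0..1}"
  by (intro integrable_continuous_interval continuous_intros g)

lemma mollify_deriv:
  "((\<lambda>y. integral {0..1} (\<lambda>x. g x * bump \<delta> (x - y))) has_real_derivative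
    - integral {0..1} (\<lambda>x. g x * bump' \<delta> (x - y))) (at y)"
proof -
  have "((\<lambda>y. integral (cbox 0 1) (\<lambda>x. g x * bump \<delta> (x - y))) has_real_derivative
      integral (cbox 0 1) (\<lambda>x. - (g x * bump' \<delta> (x - y)))) (at y within UNIV)"
  proof (rule leibniz_rule_field_derivative)
    fix y x :: real
    have "((\<lambda>y. bump \<delta> (x - y)) has_real_derivative bump' \<delta> (x - y) * (-1)) (at y)"
      by (rule DERIV_chain2[OF bump_deriv]) (auto intro!: derivative_eq_intros)
    from DERIV_cmult[OF this, of "g x"]
    show "((\<lambda>y. g x * bump \<delta> (x - y)) has_real_derivative - (g x * bump' \<delta> (x - y))) (at y within UNIV)"
      by simp
  next
    have "continuous_on (UNIV \<times> cbox 0 1) (\<lambda>p::real \<times> real. g (snd p))"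
      by (rule continuous_on_compose2[OF g]) (auto intro!: continuous_intros)
    then show "continuous_on (UNIV \<times> cbox 0 1) (\<lambda>(y, x). - (g x * bump' \<delta> (x - y)))"
      by (auto simp: case_prod_beta intro!: continuous_intros)
  qed (use integrable_bump in auto)
  then show ?thesis by simp
qed

text \<open>The signs from the two differentiations in y cancel. The integral against
  \<open>bump''\<close> is therefore at once the second space derivative of the mollified function
  and the term that the weak formulation produces for a bump centred at y; this links the equation
  to classical calculus.\<close>

lemma mollify_deriv2:
  "((\<lambda>y. - integral {0..1} (\<lambda>x. g x * bump' \<delta> (x - y))) has_real_derivative
    integral {0..1} (\<lambda>x. g x * bump'' \<delta> (x - y))) (at y)"
proof -
  have "((\<lambda>y. integral (cbox 0 1) (\<lambda>x. g x * bump' \<delta> (x - y))) has_real_derivative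
      integral (cbox 0 1) (\<lambda>x. - (g x * bump'' \<delta> (x - y)))) (at y within UNIV)"
  proof (rule leibniz_rule_field_derivative)
    fix y x :: real
    have "((\<lambda>y. bump' \<delta> (x - y)) has_real_derivative bump'' \<delta> (x - y) * (-1)) (at y)"
      by (rule DERIV_chain2[OF bump'_deriv]) (auto intro!: derivative_eq_intros)
    from DERIV_cmult[OF this, of "g x"]
    show "((\<lambda>y. g x * bump' \<delta> (x - y)) has_real_derivative - (g x * bump'' \<delta> (x - y))) (at y within UNIV)"
      by simp
  next
    have "continuous_on (UNIV \<times> cbox 0 1) (\<lambda>p::real \<times> real. g (snd p))"
      by (rule continuous_on_compose2[OF g]) (auto intro!: continuous_intros)
    then show "continuous_on (UNIV \<times> cbox 0 1) (\<lambda>(y, x). - (g x * bump'' \<delta> (x - y)))"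
      by (auto simp: case_prod_beta intro!: continuous_intros)
  qed (use integrable_bump' in auto)
  from DERIV_minus[OF this] show ?thesis by simp
qed

text \<open>A mean with a nonnegative kernel of mass one sees only values on the support, so a bound
  there suffices.\<close>

lemma mollify_le:
  assumes \<delta>: "\<delta> > 0" "\<delta> \<le> y" "y \<le> 1 - \<delta>"
    and le: "\<And>x. x \<in> {y - \<delta>..y + \<delta>} \<Longrightarrow> g x \<le> k"
  shows "integral {0..1} (\<lambda>x. g x * bump \<delta> (x - y)) \<le> k"
proof -
  have "integral {0..1} (\<lambda>x. g x * bump \<delta> (x - y)) \<le> integral {0..1} (\<lambda>x. k * bump \<delta> (x - y))"
  proof (rule integral_le[OF integrable_bump])
    show "(\<lambda>x. k * bump \<delta> (x - y)) integrable_on {0..1}"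
      by (intro integrable_continuous_interval continuous_intros)
    fix x :: real assume "x \<in> {0..1}"
    show "g x * bump \<delta> (x - y) \<le> k * bump \<delta> (x - y)"
    proof (cases "x \<in> {y - \<delta>..y + \<delta>}")
      case True
      then show ?thesis using le bump_nonneg[OF \<delta>(1)] by (simp add: mult_right_mono)
    next
      case False
      then have "bump \<delta> (x - y) = 0" using \<delta> by (intro bump_eq_0) auto
      then show ?thesis by simp
    qed
  qed
  then show ?thesis using integral_bump[OF \<delta>] by simp
qed

end

lemma mollify_approx:
  fixes g :: "real \<Rightarrow> real"
  assumes g: "continuous_on {0..1} g" and \<delta>: "\<delta> > 0" "\<delta> \<le> y" "y \<le> 1 - \<delta>"
    and le: "\<And>x. x \<in> {y - \<delta>..y + \<delta>} \<Longrightarrow> \<bar>g x - g y\<bar> \<le> k"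
  shows "\<bar>integral {0..1} (\<lambda>x. g x * bump \<delta> (x - y)) - g y\<bar> \<le> k"
proof -
  have 1: "integral {0..1} (\<lambda>x. g x * bump \<delta> (x - y)) \<le> g y + k"
    using le by (intro mollify_le[OF g \<delta>]) fastforce
  have "integral {0..1} (\<lambda>x. - g x * bump \<delta> (x - y)) \<le> - g y + k"
    using le by (intro mollify_le[OF _ \<delta>] continuous_intros g) fastforce
  with 1 show ?thesis by simp
qed

section \<open>Time increments of a solution\<close>

lemma obstacle_solD:
  assumes "obstacle_sol T z w \<eta>"
  shows "continuous_on ({0..T} \<times> {0..1}) (\<lambda>(t,x). w t x)"
    and "t \<in> {0..T} \<Longrightarrow> w t 0 = 0" and "t \<in> {0..T} \<Longrightarrow> w t 1 = 0"
    and "x \<in> {0..1} \<Longrightarrow> w 0 x = 0"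
    and "t \<in> {0..T} \<Longrightarrow> x \<in> {0..1} \<Longrightarrow> z t x \<le> w t x"
    and "sets \<eta> = sets borel"
    and "0 < a \<Longrightarrow> b < 1 \<Longrightarrow> emeasure \<eta> ({a..b} \<times> {0..T}) < \<infinity>"
    and "t \<in> {0..T} \<Longrightarrow> (\<integral>\<^sup>+ p. ennreal (case p of (x,s) \<Rightarrow> w s x - z s x)
           * indicator ({0<..<1} \<times> {0..t}) p \<partial>\<eta>) = 0"
  using assms unfolding obstacle_sol_def by blast+

lemma obstacle_sol_continuous_slice:
  assumes "obstacle_sol T z w \<eta>" "t \<in> {0..T}"
  shows "continuous_on {0..1} (w t)"
proof -
  have "continuous_on {0..1} (\<lambda>x. (\<lambda>(t,x). w t x) (t, x))"
    by (rule continuous_on_compose2[OF obstacle_solD(1)[OF assms(1)]])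
       (use assms(2) in \<open>auto intro!: continuous_intros\<close>)
  then show ?thesis by simp
qed

text \<open>Reference solution for the comparison principle: measured against it, any solution
  obtains the lower bound 0 and upper bounds of the form Cx.\<close>

lemma obstacle_sol_zero:
  assumes "\<And>t x. t \<in> {0..T} \<Longrightarrow> x \<in> {0..1} \<Longrightarrow> z t x \<le> 0"
  shows "obstacle_sol T z (\<lambda>t x. 0) (null_measure borel)"
  using assms unfolding obstacle_sol_def
  by (auto simp: set_lebesgue_integral_def)

context
  fixes T :: real and z w :: "real \<Rightarrow> real \<Rightarrow> real" and \<eta> :: "(real \<times> real) measure" and \<delta> y :: real
  assumes sol: "obstacle_sol T z w \<eta>" and \<delta>: "\<delta> > 0" "\<delta> < y" "y < 1 - \<delta>"
begin

text \<open>The total mass of \<eta> may be infinite, but the kernel is bounded and lives on the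
  strip over \<open>{y - \<delta>..y + \<delta>}\<close>, which has finite mass because
  \<open>\<delta> < y < 1 - \<delta>\<close> keeps it away from both endpoints.\<close>

lemma integrable_bump_measure:
  assumes "t \<in> {0..T}"
  shows "integrable \<eta> (\<lambda>p. indicator ({0<..<1} \<times> {0..t}) p * bump \<delta> (fst p - y))"
proof -
  have [measurable_cong]: "sets \<eta> = sets borel" by (rule obstacle_solD(6)[OF sol])
  have "compact ((\<lambda>x. bump \<delta> (x - y)) ` {0..1})"
    by (intro compact_continuous_image continuous_intros) auto
  then obtain B where B: "\<And>x. x \<in> {0..1} \<Longrightarrow> \<bar>bump \<delta> (x - y)\<bar> \<le> B"
    unfolding compact_eq_bounded_closed bounded_iff by (metis image_eqI real_norm_def)
  have [measurable]: "(\<lambda>p::real \<times> real. bump \<delta> (fst p - y)) \<in> borel_measurable borel"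
    by (intro borel_measurable_continuous_onI continuous_intros)
  have [measurable]: "{0<..<1} \<times> {0..t} \<in> sets (borel :: (real \<times> real) measure)"
    by (intro borel_Times) auto
  show ?thesis
  proof (rule integrableI_bounded_set[where A = "{y - \<delta>..y + \<delta>} \<times> {0..T}" and B = "\<bar>B\<bar>"])
    show "{y - \<delta>..y + \<delta>} \<times> {0..T} \<in> sets \<eta>"
      unfolding obstacle_solD(6)[OF sol] by (intro borel_Times) auto
    show "emeasure \<eta> ({y - \<delta>..y + \<delta>} \<times> {0..T}) < \<infinity>"
      by (rule obstacle_solD(7)[OF sol]) (use \<delta> in auto)
    show "AE p in \<eta>. p \<in> {y - \<delta>..y + \<delta>} \<times> {0..T} \<longrightarrow>
        norm (indicator ({0<..<1} \<times> {0..t}) p * bump \<delta> (fst p - y)) \<le> \<bar>B\<bar>"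
    proof (intro AE_I2 impI)
      fix p assume "p \<in> {y - \<delta>..y + \<delta>} \<times> {0..T}"
      then have "\<bar>bump \<delta> (fst p - y)\<bar> \<le> B" using \<delta> by (intro B) auto
      then show "norm (indicator ({0<..<1} \<times> {0..t}) p * bump \<delta> (fst p - y)) \<le> \<bar>B\<bar>"
        by (auto simp: indicator_def)
    qed
    show "AE p in \<eta>. p \<notin> {y - \<delta>..y + \<delta>} \<times> {0..T} \<longrightarrow>
        indicator ({0<..<1} \<times> {0..t}) p * bump \<delta> (fst p - y) = 0"
      using assms \<delta> by (intro AE_I2) (auto simp: indicator_def intro!: bump_eq_0)
  qed measurable
qed

lemma continuous_on_bump''_product:
  assumes "t \<in> {0..T}"
  shows "continuous_on ({0..t} \<times> {0..1}) (\<lambda>(s,x). w s x * bump'' \<delta> (x - y))"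
proof -
  have "continuous_on ({0..t} \<times> {0..1}) (\<lambda>(t,x). w t x)"
    by (rule continuous_on_subset[OF obstacle_solD(1)[OF sol]]) (use assms in auto)
  then show ?thesis by (auto simp: case_prod_beta intro!: continuous_intros)
qed

text \<open>The weak identity in \<open>obstacle_sol\<close> is conditional on two integrability
  premises; for a bump the first holds by continuity on a compact rectangle, the second by
  \<open>integrable_bump_measure\<close>. Writing the integral over the rectangle as an iterated one
  exhibits the heat term as a time integral of a continuous function.\<close>

lemma obstacle_sol_bump:
  assumes t: "t \<in> {0..T}"
  shows "integral {0..1} (\<lambda>x. w t x * bump \<delta> (x - y)) =
      integral {0..t} (\<lambda>s. integral {0..1} (\<lambda>x. w s x * bump'' \<delta> (x - y))) +
      (LINT p|\<eta>. indicator ({0<..<1} \<times> {0..t}) p * bump \<delta> (fst p - y))"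
proof -
  note cont = continuous_on_bump''_product[OF t]
  have int: "set_integrable lborel ({0..t} \<times> {0..1}) (\<lambda>(s,x). w s x * bump'' \<delta> (x - y))"
    unfolding set_integrable_def by (rule borel_integrable_compact[OF _ cont]) (intro compact_Times compact_Icc)
  have int\<eta>: "set_integrable \<eta> ({0<..<1} \<times> {0..t}) (\<lambda>(x,s). bump \<delta> (x - y))"
    using integrable_bump_measure[OF t] by (simp add: set_integrable_def case_prod_beta)
  have "(LINT p : {0..t} \<times> {0..1} | lborel. (case p of (s,x) \<Rightarrow> w s x * bump'' \<delta> (x - y))) =
      integral ({0..t} \<times> {0..1}) (\<lambda>(s,x). w s x * bump'' \<delta> (x - y))"
    by (rule set_borel_integral_eq_integral(2)[OF int])
  also have "\<dots> = integral {0..t} (\<lambda>s. integral {0..1} (\<lambda>x. w s x * bump'' \<delta> (x - y)))"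
    using integral_prod_continuous[of "0::real" "0::real" t 1 "\<lambda>(s,x). w s x * bump'' \<delta> (x - y)"] cont
    by (simp add: cbox_Pair_eq)
  finally have double: "(LINT p : {0..t} \<times> {0..1} | lborel. (case p of (s,x) \<Rightarrow> w s x * bump'' \<delta> (x - y))) = \<dots>" .
  have "integral {0..1} (\<lambda>x. w t x * bump \<delta> (x - y)) =
          (LINT p : {0..t} \<times> {0..1} | lborel. (case p of (s,x) \<Rightarrow> w s x * bump'' \<delta> (x - y))) +
          (LINT p : {0<..<1} \<times> {0..t} | \<eta>. (case p of (x,s) \<Rightarrow> bump \<delta> (x - y)))"
    using sol test_fun_bump[OF \<delta>] int int\<eta> t unfolding obstacle_sol_def by blast
  then show ?thesis unfolding double by (simp add: set_lebesgue_integral_def case_prod_beta)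
qed

context
  fixes t1 t2 :: real
  assumes t: "0 \<le> t1" "t1 \<le> t2" "t2 \<le> T"
begin

lemma integral_bump''_diff:
  "integral {0..t2} (\<lambda>s. integral {0..1} (\<lambda>x. w s x * bump'' \<delta> (x - y)))
   - integral {0..t1} (\<lambda>s. integral {0..1} (\<lambda>x. w s x * bump'' \<delta> (x - y)))
   = integral {t1..t2} (\<lambda>s. integral {0..1} (\<lambda>x. w s x * bump'' \<delta> (x - y)))"
proof -
  have "continuous_on ({0..t2} \<times> {0..1}) (\<lambda>(t,x). w t x)"
    by (rule continuous_on_subset[OF obstacle_solD(1)[OF sol]]) (use t in auto)
  then have "(\<lambda>s. integral {0..1} (\<lambda>x. w s x * bump'' \<delta> (x - y))) integrable_on {0..t2}"
    by (intro integrable_continuous_interval continuous_on_integral_bump'')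
  from Henstock_Kurzweil_Integration.integral_combine[OF t(1,2) this] show ?thesis by simp
qed

text \<open>Both \<eta> and the kernel are nonnegative, so the measure term can only grow with time:
  every solution is a weak supersolution of the heat equation, whatever its obstacle.\<close>

lemma obstacle_sol_increment_ge:
  "integral {t1..t2} (\<lambda>s. integral {0..1} (\<lambda>x. w s x * bump'' \<delta> (x - y)))
   \<le> integral {0..1} (\<lambda>x. w t2 x * bump \<delta> (x - y)) - integral {0..1} (\<lambda>x. w t1 x * bump \<delta> (x - y))"
proof -
  have "(LINT p|\<eta>. indicator ({0<..<1} \<times> {0..t1}) p * bump \<delta> (fst p - y))
      \<le> (LINT p|\<eta>. indicator ({0<..<1} \<times> {0..t2}) p * bump \<delta> (fst p - y))"
    by (intro integral_mono integrable_bump_measure mult_right_mono bump_nonneg \<delta>)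
       (use t in \<open>auto simp: indicator_def\<close>)
  then show ?thesis
    using obstacle_sol_bump[of t1] obstacle_sol_bump[of t2] integral_bump''_diff t by auto
qed

text \<open>By Markov's inequality, c times the mass of the box is at most the integral of w - z
  against \<eta>, which is 0. So \<eta> does not charge the box and the heat equation holds there
  without a source.\<close>

lemma obstacle_sol_increment_eq:
  assumes "c > 0"
    and gap: "\<And>s x. s \<in> {t1..t2} \<Longrightarrow> x \<in> {y - \<delta>..y + \<delta>} \<Longrightarrow> z s x + c \<le> w s x"
  shows "integral {0..1} (\<lambda>x. w t2 x * bump \<delta> (x - y)) - integral {0..1} (\<lambda>x. w t1 x * bump \<delta> (x - y))
   = integral {t1..t2} (\<lambda>s. integral {0..1} (\<lambda>x. w s x * bump'' \<delta> (x - y)))"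
proof -
  let ?Q = "{y - \<delta>..y + \<delta>} \<times> {t1..t2}"
  have Q: "?Q \<in> sets \<eta>"
    unfolding obstacle_solD(6)[OF sol] by (intro borel_Times) auto
  have "ennreal c * emeasure \<eta> ?Q = (\<integral>\<^sup>+ p. ennreal c * indicator ?Q p \<partial>\<eta>)"
    by (rule nn_integral_cmult_indicator[OF Q, symmetric])
  also have "\<dots> \<le> (\<integral>\<^sup>+ p. ennreal (case p of (x,s) \<Rightarrow> w s x - z s x)
           * indicator ({0<..<1} \<times> {0..T}) p \<partial>\<eta>)"
  proof (rule nn_integral_mono)
    fix p :: "real \<times> real"
    show "ennreal c * indicator ?Q p \<le> ennreal (case p of (x,s) \<Rightarrow> w s x - z s x)
           * indicator ({0<..<1} \<times> {0..T}) p"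
    proof (cases "p \<in> ?Q")
      case True
      then have "p \<in> {0<..<1} \<times> {0..T}" using \<delta> t by auto
      moreover have "c \<le> (case p of (x,s) \<Rightarrow> w s x - z s x)" using gap True by fastforce
      ultimately show ?thesis using True by (auto intro: ennreal_leI)
    qed auto
  qed
  also have "\<dots> = 0" using obstacle_solD(8)[OF sol] t by auto
  finally have "ennreal c * emeasure \<eta> ?Q = 0" by simp
  then have "emeasure \<eta> ?Q = 0" using \<open>c > 0\<close> by simp
  then have "?Q \<in> null_sets \<eta>" using Q by auto
  then have AE: "AE p in \<eta>. p \<notin> ?Q" by (rule AE_not_in)
  \<comment> \<open>The integrands can differ only at times in \<open>{t1<..t2}\<close>, and there
    either the point lies in the null box or the kernel vanishes.\<close>
  have "(LINT p|\<eta>. indicator ({0<..<1} \<times> {0..t1}) p * bump \<delta> (fst p - y))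
      = (LINT p|\<eta>. indicator ({0<..<1} \<times> {0..t2}) p * bump \<delta> (fst p - y))"
  proof (rule integral_cong_AE)
    show "AE p in \<eta>. indicator ({0<..<1} \<times> {0..t1}) p * bump \<delta> (fst p - y)
        = indicator ({0<..<1} \<times> {0..t2}) p * bump \<delta> (fst p - y)"
      using AE
    proof eventually_elim
      case (elim p)
      show ?case
      proof (cases "fst p \<in> {y - \<delta>..y + \<delta>}")
        case True
        then have "snd p \<notin> {t1..t2}" using elim by (cases p) auto
        then show ?thesis using t by (cases p) (auto simp: indicator_def)
      next
        case False
        then have "bump \<delta> (fst p - y) = 0" using \<delta> by (intro bump_eq_0) auto
        then show ?thesis by simp
      qed
    qed
  qed (use t in \<open>auto intro!: borel_measurable_integrable integrable_bump_measure\<close>)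
  then show ?thesis
    using obstacle_sol_bump[of t1] obstacle_sol_bump[of t2] integral_bump''_diff t by auto
qed

end

end

section \<open>Comparison principle\<close>

text \<open>Otherwise f' would be positive just to the right of the critical point y, and f would
  exceed its maximum there.\<close>

lemma second_deriv_nonpos_at_local_max:
  fixes f f' :: "real \<Rightarrow> real"
  assumes f: "\<And>x. (f has_real_derivative f' x) (at x)"
    and f': "(f' has_real_derivative l) (at y)"
    and "d > 0" and max: "\<And>x. \<bar>y - x\<bar> < d \<Longrightarrow> f x \<le> f y"
  shows "l \<le> 0"
proof (rule ccontr)
  assume "\<not> l \<le> 0"
  then obtain e where e: "e > 0" "\<And>h. h > 0 \<Longrightarrow> h < e \<Longrightarrow> f' y < f' (y + h)"
    using DERIV_pos_inc_right[OF f'] by auto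
  have "f' y = 0" using DERIV_local_max[OF f \<open>d > 0\<close>] max by blast
  define h where "h = min d e / 2"
  have h: "h > 0" "h < d" "h < e" using e(1) \<open>d > 0\<close> by (auto simp: h_def)
  have "f y < f (y + h)"
  proof (rule DERIV_pos_imp_increasing_open[where f = f])
    fix x assume x: "y < x" "x < y + h"
    then have "f' x > 0" using e(2)[of "x - y"] h \<open>f' y = 0\<close> by auto
    then show "\<exists>l. (f has_real_derivative l) (at x) \<and> l > 0" using f by blast
  next
    show "continuous_on {y..y + h} f"
      by (intro continuous_at_imp_continuous_on ballI DERIV_isCont[OF f])
  qed (use h in simp)
  moreover have "f (y + h) \<le> f y" by (rule max) (use h in auto)
  ultimately show False by simp
qed

text \<open>Maximise the mollification of v minus Cx minus a penalty \<epsilon> t. The second space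
  derivative at the maximum is nonpositive, so by \<open>sub\<close> the mollification gains at most
  \<epsilon> / 2 per unit of time just before; maximality demands a gain of at least \<epsilon>. The
  hypothesis \<open>sub\<close> speaks only of boxes where v > Cx, because only there will the
  measure of the upper solution be known to vanish.\<close>

lemma subsolution_le_linear:
  fixes v :: "real \<Rightarrow> real \<Rightarrow> real"
  assumes cont: "continuous_on ({0..S} \<times> {0..1}) (\<lambda>(t,x). v t x)"
    and left: "\<And>t. t \<in> {0..S} \<Longrightarrow> v t 0 \<le> 0"
    and right: "\<And>t. t \<in> {0..S} \<Longrightarrow> v t 1 \<le> C"
    and init: "\<And>x. x \<in> {0..1} \<Longrightarrow> v 0 x \<le> C * x"
    and sub: "\<And>t1 t2 \<delta> y. 0 \<le> t1 \<Longrightarrow> t1 \<le> t2 \<Longrightarrow> t2 \<le> S \<Longrightarrow> \<delta> > 0 \<Longrightarrow> \<delta> < y \<Longrightarrow> y < 1 - \<delta> \<Longrightarrow>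
      (\<And>s x. s \<in> {t1..t2} \<Longrightarrow> x \<in> {y - \<delta>..y + \<delta>} \<Longrightarrow> v s x > C * x) \<Longrightarrow>
      integral {0..1} (\<lambda>x. v t2 x * bump \<delta> (x - y)) - integral {0..1} (\<lambda>x. v t1 x * bump \<delta> (x - y))
      \<le> integral {t1..t2} (\<lambda>s. integral {0..1} (\<lambda>x. v s x * bump'' \<delta> (x - y)))"
    and t: "t \<in> {0..S}" and x: "x \<in> {0..1}"
  shows "v t x \<le> C * x"
proof (rule ccontr)
  define D where "D p = v (fst p) (snd p) - C * snd p" for p
  assume "\<not> v t x \<le> C * x"
  then have D0: "D (t, x) > 0" by (simp add: D_def)
  \<comment> \<open>The excess is 4m. The penalty takes at most 2m by the choice of
    \<open>\<epsilon>\<close> (S + 1 guards against S = 0), and each of two mollification errors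
    takes at most m / 2; this still leaves D \<ge> m at the maximum point of
    \<open>H\<close>.\<close>
  define m where "m = D (t, x) / 4"
  define \<epsilon> where "\<epsilon> = D (t, x) / (2 * (S + 1))"
  have S: "S \<ge> 0" using t by auto
  have m: "m > 0" and \<epsilon>: "\<epsilon> > 0" using D0 S by (auto simp: m_def \<epsilon>_def)
  have "\<epsilon> * t \<le> \<epsilon> * (S + 1)" using \<epsilon> t by (intro mult_left_mono) auto
  also have "\<dots> = 2 * m" using S by (simp add: \<epsilon>_def m_def field_simps)
  finally have Dt: "D (t, x) - \<epsilon> * t \<ge> 2 * m" by (simp add: m_def)
  let ?R = "{0..S} \<times> {0..1::real}"
  have R: "compact ?R" by (intro compact_Times compact_Icc)
  have contD: "continuous_on ?R D"
    unfolding D_def using cont by (auto simp: case_prod_beta intro!: continuous_intros)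
  obtain r1 where r1: "r1 > 0" "\<And>p q. p \<in> ?R \<Longrightarrow> q \<in> ?R \<Longrightarrow> dist q p < r1 \<Longrightarrow> dist (D q) (D p) < m / 2"
    using compact_uniformly_continuous[OF contD R] m
    unfolding uniformly_continuous_on_def by (metis half_gt_zero)
  obtain r2 where r2: "r2 > 0" "\<And>p q. p \<in> ?R \<Longrightarrow> q \<in> ?R \<Longrightarrow> dist q p < r2 \<Longrightarrow>
      dist (v (fst q) (snd q)) (v (fst p) (snd p)) < m / 2"
    using compact_uniformly_continuous[OF cont R] m
    unfolding uniformly_continuous_on_def case_prod_beta by (metis half_gt_zero)
  \<comment> \<open>Moving both coordinates by at most \<delta> moves the point by at most 2
    \<delta>, which must stay below both radii.\<close>
  define \<delta> where "\<delta> = min r1 r2 / 3"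
  have \<delta>: "\<delta> > 0" "2 * \<delta> < r1" "2 * \<delta> < r2" using r1(1) r2(1) by (auto simp: \<delta>_def)
  have near: "dist (s, a) (s', a') \<le> \<bar>s - s'\<bar> + \<bar>a - a'\<bar>" for s a s' a' :: real
    using dist_Pair_Pair[of s a s' a'] sqrt_sum_squares_le_sum_abs[of "s - s'" "a - a'"]
    by (simp add: dist_real_def)
  have boundary: "D (s, 0) \<le> 0" "D (s, 1) \<le> 0" if "s \<in> {0..S}" for s
    using left[OF that] right[OF that] by (auto simp: D_def)
  \<comment> \<open>D is nonpositive at x = 0, at x = 1 and at time 0, and positive within \<delta>
    of a point where D \<ge> m. Such a point is thus farther than \<delta> from all three: the
    kernel fits into the unit interval and there is room to step back in time. No distance from the
    final time S is claimed.\<close>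
  have inside: "\<delta> < a \<and> a < 1 - \<delta> \<and> \<delta> < s \<and>
      (\<forall>s' a'. s' \<in> {s - \<delta>..s + \<delta>} \<longrightarrow> a' \<in> {a - \<delta>..a + \<delta>} \<longrightarrow> s' \<in> {0..S} \<longrightarrow> v s' a' > C * a')"
    if sa: "s \<in> {0..S}" "a \<in> {0..1}" "D (s, a) \<ge> m" for s a
  proof -
    have close: "D (s', a') > 0" if "s' \<in> {0..S}" "a' \<in> {0..1}" "\<bar>s' - s\<bar> \<le> \<delta>" "\<bar>a' - a\<bar> \<le> \<delta>" for s' a'
    proof -
      have "dist (s', a') (s, a) < r1" using near[of s' a' s a] that \<delta> by linarith
      then have "dist (D (s', a')) (D (s, a)) < m / 2" using r1(2) that sa by auto
      then show ?thesis using sa(3) m unfolding dist_real_def by linarith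
    qed
    have "\<delta> < a" using close[of s 0] boundary(1)[of s] sa \<delta> by (cases "a \<le> \<delta>") auto
    moreover have "a < 1 - \<delta>" using close[of s 1] boundary(2)[of s] sa \<delta> by (cases "1 - \<delta> \<le> a") auto
    moreover have "D (0, a) \<le> 0" using init[of a] sa by (simp add: D_def)
    then have "\<delta> < s" using close[of 0 a] sa S \<delta> by (cases "s \<le> \<delta>") auto
    ultimately show ?thesis using close by (auto simp: D_def abs_le_iff)
  qed
  define V where "V s a = integral {0..1} (\<lambda>x. v s x * bump \<delta> (x - a))" for s a
  have slice: "continuous_on {0..1} (v s)" if "s \<in> {0..S}" for s
  proof -
    have "continuous_on {0..1} (\<lambda>x. (\<lambda>(t,x). v t x) (s, x))"
      by (rule continuous_on_compose2[OF cont]) (use that in \<open>auto intro!: continuous_intros\<close>)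
    then show ?thesis by simp
  qed
  have V: "\<bar>V s a - v s a\<bar> \<le> m / 2" if "s \<in> {0..S}" "a \<in> {\<delta>..1 - \<delta>}" for s a
    unfolding V_def
  proof (rule mollify_approx[OF slice])
    fix x assume x: "x \<in> {a - \<delta>..a + \<delta>}"
    have "dist (s, x) (s, a) < r2" using near[of s x s a] x \<delta> by auto
    then have "dist (v s x) (v s a) < m / 2" using r2(2)[of "(s, a)" "(s, x)"] that x \<delta> by auto
    then show "\<bar>v s x - v s a\<bar> \<le> m / 2" by (simp add: dist_real_def)
  qed (use that \<delta> in auto)
  define H where "H p = V (fst p) (snd p) - C * snd p - \<epsilon> * fst p" for p
  let ?K = "{0..S} \<times> {\<delta>..1 - \<delta>}"
  have "\<epsilon> * t \<ge> 0" using \<epsilon> t by simp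
  then have "D (t, x) \<ge> m" using Dt m by linarith
  then have tx: "(t, x) \<in> ?K" using inside[OF t x] t by auto
  have "continuous_on (?K \<times> cbox 0 1) (\<lambda>(p, x). v (fst p) x * bump \<delta> (x - snd p))"
  proof -
    have "continuous_on (?K \<times> cbox 0 1) (\<lambda>q. (\<lambda>(t,x). v t x) (fst (fst q), snd q))"
      by (rule continuous_on_compose2[OF cont]) (auto intro!: continuous_intros)
    then show ?thesis by (auto simp: case_prod_beta intro!: continuous_intros)
  qed
  then have "continuous_on ?K (\<lambda>p. V (fst p) (snd p))"
    unfolding V_def using integral_continuous_on_param by fastforce
  then have "continuous_on ?K H"
    unfolding H_def by (intro continuous_intros)
  moreover have "compact ?K" by (intro compact_Times compact_Icc)
  ultimately obtain p where p: "p \<in> ?K" "\<And>q. q \<in> ?K \<Longrightarrow> H q \<le> H p"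
    using continuous_attains_sup[of ?K H] tx by blast
  obtain s a where pa: "p = (s, a)" by (cases p)
  have sa: "s \<in> {0..S}" "a \<in> {\<delta>..1 - \<delta>}" using p(1) pa by auto
  have "H (t, x) \<ge> D (t, x) - m / 2 - \<epsilon> * t" 
  proof -
    have "\<bar>V t x - v t x\<bar> \<le> m / 2" using V tx by auto
    then have "v t x - m / 2 \<le> V t x" unfolding abs_le_iff by linarith
    then show ?thesis by (simp add: H_def D_def)
  qed
  then have "H (s, a) \<ge> 3 / 2 * m" using p(2)[OF tx] Dt unfolding pa by linarith
  moreover have "\<epsilon> * s \<ge> 0" using \<epsilon> sa by auto
  moreover have "V s a - v s a \<le> m / 2" using V[OF sa] unfolding abs_le_iff by (rule conjunct1)
  ultimately have "D (s, a) \<ge> m" by (simp add: H_def D_def)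
  then have ins: "\<delta> < a" "a < 1 - \<delta>" "\<delta> < s"
    and pos: "\<And>s' a'. s' \<in> {s - \<delta>..s + \<delta>} \<Longrightarrow> a' \<in> {a - \<delta>..a + \<delta>} \<Longrightarrow> s' \<in> {0..S} \<Longrightarrow> v s' a' > C * a'"
    using inside[of s a] sa \<delta> by auto
  define G where "G s = integral {0..1} (\<lambda>x. v s x * bump'' \<delta> (x - a))" for s
  \<comment> \<open>Cx has zero second derivative and the penalty does not depend on space, so
    \<open>G s\<close> is the second derivative at a of the slice of \<open>H\<close> at time
    s.\<close>
  have "G s \<le> 0"
  proof (rule second_deriv_nonpos_at_local_max)
    show "((\<lambda>a. V s a - C * a) has_real_derivative
        - integral {0..1} (\<lambda>x. v s x * bump' \<delta> (x - y)) - C) (at y)" for y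
      unfolding V_def by (rule derivative_eq_intros mollify_deriv[OF slice[OF sa(1)]] refl | simp)+
    show "((\<lambda>y. - integral {0..1} (\<lambda>x. v s x * bump' \<delta> (x - y)) - C) has_real_derivative G s) (at a)"
      unfolding G_def using DERIV_diff[OF mollify_deriv2[OF slice[OF sa(1)]] DERIV_const] by simp
    show "min (a - \<delta>) (1 - \<delta> - a) > 0" using ins by simp
    fix y assume "\<bar>a - y\<bar> < min (a - \<delta>) (1 - \<delta> - a)"
    then have "(s, y) \<in> ?K" using sa by auto
    from p(2)[OF this] show "V s y - C * y \<le> V s a - C * a" by (simp add: H_def pa)
  qed
  have contG: "continuous_on {0..S} G"
    unfolding G_def by (rule continuous_on_integral_bump''[OF cont])
  then obtain d where d: "d > 0" "\<And>s'. s' \<in> {0..S} \<Longrightarrow> dist s' s < d \<Longrightarrow> dist (G s') (G s) < \<epsilon> / 2"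
    using \<epsilon> sa(1) unfolding continuous_on_iff by (metis half_gt_zero)
  \<comment> \<open>The bound \<delta> keeps the step inside the region where v > Cx is known and
    keeps \<open>t1\<close> nonnegative; d / 2 keeps \<open>G\<close> below \<epsilon> / 2. Only
    earlier times occur, so s = S is no exception.\<close>
  define t1 where "t1 = s - min (d / 2) \<delta>"
  have t1: "t1 < s" "t1 \<ge> 0" "s - t1 \<le> \<delta>" "s - t1 < d" using d(1) \<delta> ins by (auto simp: t1_def)
  have "V s a - V t1 a \<le> integral {t1..s} G"
    unfolding V_def G_def
    by (rule sub) (use t1 sa ins \<delta> in \<open>auto intro!: pos\<close>)
  also have "\<dots> \<le> integral {t1..s} (\<lambda>_. \<epsilon> / 2)"
  proof (rule integral_le)
    show "G integrable_on {t1..s}"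
      by (intro integrable_continuous_interval continuous_on_subset[OF contG]) (use t1 sa in auto)
    fix s' assume s': "s' \<in> {t1..s}"
    have "dist (G s') (G s) < \<epsilon> / 2" by (rule d(2)) (use s' t1 sa in \<open>auto simp: dist_real_def\<close>)
    then show "G s' \<le> \<epsilon> / 2" using \<open>G s \<le> 0\<close> unfolding dist_real_def by linarith
  qed auto
  also have "\<dots> = (s - t1) * (\<epsilon> / 2)" using t1 by simp
  finally have up: "V s a - V t1 a \<le> (s - t1) * (\<epsilon> / 2)" .
  have "H (t1, a) \<le> H (s, a)" using p(2)[of "(t1, a)"] pa sa t1 by auto
  then have "(s - t1) * \<epsilon> \<le> V s a - V t1 a" by (simp add: H_def algebra_simps)
  moreover have "(s - t1) * \<epsilon> > 0" using t1 \<epsilon> by simp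
  ultimately show False using up by simp
qed

text \<open>The offsets \<open>h1\<close> and \<open>h2\<close> permit the comparison of a solution
  with its own time shift. A shifted solution need not start from zero, so it is not itself an
  \<open>obstacle_sol\<close>; \<open>init\<close> takes over the role of the zero initial value.
  The second measure may be active where the first is not: its contribution has the favourable sign,
  by \<open>obstacle_sol_increment_ge\<close>.\<close>

lemma obstacle_sol_comparison:
  assumes sol1: "obstacle_sol T z1 w1 \<eta>1" and sol2: "obstacle_sol T z2 w2 \<eta>2"
    and h: "h1 \<ge> 0" "h2 \<ge> 0" "h1 + S \<le> T" "h2 + S \<le> T"
    and C: "C \<ge> 0"
    and init: "\<And>x. x \<in> {0..1} \<Longrightarrow> w1 h1 x - w2 h2 x \<le> C * x"
    and obs: "\<And>t x. t \<in> {0..S} \<Longrightarrow> x \<in> {0..1} \<Longrightarrow> z1 (h1 + t) x \<le> z2 (h2 + t) x + C * x"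
    and t: "t \<in> {0..S}" and x: "x \<in> {0..1}"
  shows "w1 (h1 + t) x - w2 (h2 + t) x \<le> C * x"
proof -
  define v where "v t x = w1 (h1 + t) x - w2 (h2 + t) x" for t x
  have shift: "continuous_on ({0..S} \<times> {0..1}) (\<lambda>(t,x). w (h + t) x)"
    if "obstacle_sol T z w \<eta>" "h \<ge> 0" "h + S \<le> T" for z w \<eta> h
  proof -
    have "continuous_on ({0..S} \<times> {0..1}) (\<lambda>p. (\<lambda>(t,x). w t x) (h + fst p, snd p))"
      by (rule continuous_on_compose2[OF obstacle_solD(1)[OF that(1)]])
         (use that(2,3) in \<open>auto intro!: continuous_intros\<close>)
    then show ?thesis by (simp add: case_prod_beta)
  qed
  have cont: "continuous_on ({0..S} \<times> {0..1}) (\<lambda>(t,x). v t x)"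
    unfolding v_def using shift[OF sol1 h(1,3)] shift[OF sol2 h(2,4)]
    by (auto simp: case_prod_beta intro!: continuous_intros)
  have "v t x \<le> C * x"
  proof (rule subsolution_le_linear[OF cont _ _ _ _ t x])
    fix t assume "t \<in> {0..S}"
    then have "h1 + t \<in> {0..T}" "h2 + t \<in> {0..T}" using h by auto
    then show "v t 0 \<le> 0" "v t 1 \<le> C"
      using obstacle_solD(2,3)[OF sol1] obstacle_solD(2,3)[OF sol2] C by (auto simp: v_def)
  next
    show "v 0 x \<le> C * x" if "x \<in> {0..1}" for x using init[OF that] by (simp add: v_def)
  next
    fix t1 t2 \<delta> y :: real
    assume t12: "0 \<le> t1" "t1 \<le> t2" "t2 \<le> S" and \<delta>: "\<delta> > 0" "\<delta> < y" "y < 1 - \<delta>"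
      and pos: "\<And>s x. s \<in> {t1..t2} \<Longrightarrow> x \<in> {y - \<delta>..y + \<delta>} \<Longrightarrow> v s x > C * x"
    \<comment> \<open>On this compact box v - Cx attains its minimum, which is the uniform gap
      \<open>c\<close> demanded by \<open>obstacle_sol_increment_eq\<close>.\<close>
    let ?Q = "{t1..t2} \<times> {y - \<delta>..y + \<delta>}"
    have "continuous_on ?Q (\<lambda>(s,x). v s x)"
      by (rule continuous_on_subset[OF cont]) (use t12 \<delta> in auto)
    then have "continuous_on ?Q (\<lambda>p. v (fst p) (snd p) - C * snd p)"
      by (auto simp: case_prod_beta intro!: continuous_intros)
    moreover have "compact ?Q" "?Q \<noteq> {}" using t12 \<delta> by (auto intro!: compact_Times)
    ultimately obtain q where q: "q \<in> ?Q"
      "\<And>p. p \<in> ?Q \<Longrightarrow> v (fst q) (snd q) - C * snd q \<le> v (fst p) (snd p) - C * snd p"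
      using continuous_attains_inf[of ?Q "\<lambda>p. v (fst p) (snd p) - C * snd p"] by blast
    define c where "c = v (fst q) (snd q) - C * snd q"
    have c: "c > 0" using pos q(1) by (auto simp: c_def)
    have gap: "z1 (h1 + s) x + c \<le> w1 (h1 + s) x" if "s \<in> {t1..t2}" "x \<in> {y - \<delta>..y + \<delta>}" for s x
    proof -
      have "c \<le> v s x - C * x" using q(2)[of "(s, x)"] that by (simp add: c_def)
      moreover have "z1 (h1 + s) x \<le> z2 (h2 + s) x + C * x"
        by (rule obs) (use that t12 \<delta> in auto)
      moreover have "z2 (h2 + s) x \<le> w2 (h2 + s) x"
        by (rule obstacle_solD(5)[OF sol2]) (use that t12 \<delta> h in auto)
      ultimately show ?thesis by (simp add: v_def)
    qed
    define G1 where "G1 s = integral {0..1} (\<lambda>x. w1 s x * bump'' \<delta> (x - y))" for s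
    define G2 where "G2 s = integral {0..1} (\<lambda>x. w2 s x * bump'' \<delta> (x - y))" for s
    have G1: "continuous_on {0..T} G1" and G2: "continuous_on {0..T} G2"
      unfolding G1_def G2_def
      by (intro continuous_on_integral_bump'' obstacle_solD(1)[OF sol1] obstacle_solD(1)[OF sol2])+
    have s1: "integral {0..1} (\<lambda>x. w1 (h1 + t2) x * bump \<delta> (x - y))
        - integral {0..1} (\<lambda>x. w1 (h1 + t1) x * bump \<delta> (x - y)) = integral {h1 + t1..h1 + t2} G1"
      unfolding G1_def
    proof (rule obstacle_sol_increment_eq[OF sol1 \<delta> _ _ _ c])
      fix s x assume "s \<in> {h1 + t1..h1 + t2}" "x \<in> {y - \<delta>..y + \<delta>}"
      then show "z1 s x + c \<le> w1 s x" using gap[of "s - h1" x] by auto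
    qed (use t12 h in auto)
    have s2: "integral {h2 + t1..h2 + t2} G2 \<le> integral {0..1} (\<lambda>x. w2 (h2 + t2) x * bump \<delta> (x - y))
        - integral {0..1} (\<lambda>x. w2 (h2 + t1) x * bump \<delta> (x - y))"
      unfolding G2_def by (rule obstacle_sol_increment_ge[OF sol2 \<delta>]) (use t12 h in auto)
    \<comment> \<open>The two solutions are read at different clock times; translation brings both
      integrals to \<open>{t1..t2}\<close>, where they can be subtracted.\<close>
    have sh: "integral {h + t1..h + t2} G = integral {t1..t2} (\<lambda>s. G (h + s))"
      for h and G :: "real \<Rightarrow> real"
      using integral_shift_Icc_real[of t1 t2 G h] by (simp add: o_def add.commute)
    have slices: "continuous_on {0..1} (w1 (h1 + s))" "continuous_on {0..1} (w2 (h2 + s))"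
      if "s \<in> {0..S}" for s
      using that h by (auto intro!: obstacle_sol_continuous_slice[OF sol1] obstacle_sol_continuous_slice[OF sol2])
    have split: "integral {0..1} (\<lambda>x. v s x * f x) =
        integral {0..1} (\<lambda>x. w1 (h1 + s) x * f x) - integral {0..1} (\<lambda>x. w2 (h2 + s) x * f x)"
      if "s \<in> {0..S}" "continuous_on {0..1} f" for s f
      unfolding v_def left_diff_distrib
      by (intro integral_diff integrable_continuous_interval continuous_intros slices that)
    have bumps: "continuous_on {0..1} (\<lambda>x. bump \<delta> (x - y))" "continuous_on {0..1} (\<lambda>x. bump'' \<delta> (x - y))"
      by (intro continuous_intros)+
    have "integral {t1..t2} (\<lambda>s. integral {0..1} (\<lambda>x. v s x * bump'' \<delta> (x - y)))
        = integral {t1..t2} (\<lambda>s. G1 (h1 + s) - G2 (h2 + s))"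
      by (rule integral_cong) (use t12 in \<open>auto simp: split bumps G1_def G2_def\<close>)
    also have "\<dots> = integral {t1..t2} (\<lambda>s. G1 (h1 + s)) - integral {t1..t2} (\<lambda>s. G2 (h2 + s))"
      by (intro integral_diff integrable_continuous_interval continuous_on_compose2[OF G1]
          continuous_on_compose2[OF G2] continuous_intros) (use t12 h in auto)
    finally show "integral {0..1} (\<lambda>x. v t2 x * bump \<delta> (x - y)) - integral {0..1} (\<lambda>x. v t1 x * bump \<delta> (x - y))
      \<le> integral {t1..t2} (\<lambda>s. integral {0..1} (\<lambda>x. v s x * bump'' \<delta> (x - y)))"
      using s1 s2 sh[of h1 G1] sh[of h2 G2] t12 by (simp add: split bumps)
  qed
  then show ?thesis by (simp add: v_def)
qed

section \<open>The space of obstacles and regularity of solutions\<close>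

text \<open>The quotient f(x) / x extends continuously to 0 by the value f'(0), so it is bounded by
  compactness. A supremum of reals says nothing about its members without such a bound.\<close>

lemma H_norm_bdd_above:
  assumes "in_H f"
  shows "bdd_above ((\<lambda>x. \<bar>f x / x\<bar>) ` {0<..1})"
proof -
  obtain L where L: "(f has_real_derivative L) (at 0 within {0..1})"
    using assms unfolding in_H_def real_differentiable_def by blast
  define g where "g x = (if x = 0 then L else f x / x)" for x
  have "continuous (at x within {0..1}) g" if x: "x \<in> {0..1}" for x
  proof (cases "x = 0")
    case True
    have "((\<lambda>x. f x / x) \<longlongrightarrow> L) (at 0 within {0..1})"
      using L assms unfolding has_field_derivative_iff in_H_def by simp
    then have "(g \<longlongrightarrow> L) (at 0 within {0..1})"
      by (rule Lim_transform_eventually) (auto simp: eventually_at_filter g_def)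
    then show ?thesis using True by (simp add: continuous_within g_def)
  next
    case False
    have "continuous (at x within {0..1}) (\<lambda>x. f x / x)"
      using assms x False unfolding in_H_def continuous_on_eq_continuous_within
      by (intro continuous_intros) auto
    then show ?thesis
    proof (rule continuous_transform_within)
      show "\<bar>x\<bar> > 0" using False by simp
    qed (use False x in \<open>auto simp: g_def dist_real_def\<close>)
  qed
  then have "continuous_on {0..1} (\<lambda>x. \<bar>g x\<bar>)"
    by (intro continuous_intros) (simp add: continuous_on_eq_continuous_within)
  then have "bdd_above ((\<lambda>x. \<bar>g x\<bar>) ` {0..1})"
    by (intro bounded_imp_bdd_above compact_imp_bounded compact_continuous_image) auto
  then have "bdd_above ((\<lambda>x. \<bar>g x\<bar>) ` {0<..1})"
    by (rule bdd_above_mono) (intro image_mono, auto)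
  moreover have "(\<lambda>x. \<bar>f x / x\<bar>) ` {0<..1} = (\<lambda>x. \<bar>g x\<bar>) ` {0<..1}"
    by (rule image_cong) (auto simp: g_def)
  ultimately show ?thesis by simp
qed

text \<open>Together with \<open>H_norm_le\<close> this trades the norm for an inequality |f(x)|
  \<le> c x, the form in which the comparison principle speaks and which makes sense at x = 0
  too.\<close>

lemma in_H_le_H_norm:
  assumes "in_H f" "x \<in> {0..1}"
  shows "\<bar>f x\<bar> \<le> H_norm f * x"
proof (cases "x = 0")
  case True
  then show ?thesis using assms by (simp add: in_H_def)
next
  case False
  then have "x \<in> {0<..1}" using assms(2) by auto
  then have "\<bar>f x / x\<bar> \<le> H_norm f"
    unfolding H_norm_def by (rule cSUP_upper[OF _ H_norm_bdd_above[OF assms(1)]])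
  then show ?thesis using \<open>x \<in> {0<..1}\<close> by (simp add: abs_divide field_simps)
qed

lemma H_norm_nonneg:
  assumes "in_H f" shows "0 \<le> H_norm f"
  using in_H_le_H_norm[OF assms, of 1] by simp

lemma H_norm_le:
  assumes "\<And>x. x \<in> {0..1} \<Longrightarrow> \<bar>f x\<bar> \<le> c * x"
  shows "H_norm f \<le> c"
  unfolding H_norm_def
proof (rule cSUP_least)
  fix x :: real assume x: "x \<in> {0<..1}"
  then show "\<bar>f x / x\<bar> \<le> c" using assms[of x] by (simp add: abs_divide field_simps)
qed auto

lemma in_H_diff: "in_H f \<Longrightarrow> in_H g \<Longrightarrow> in_H (\<lambda>x. f x - g x)"
  unfolding in_H_def by (auto intro!: continuous_intros differentiable_diff)

lemma H_norm_triangle: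
  assumes "in_H f" "in_H g"
  shows "H_norm f \<le> H_norm g + H_norm (\<lambda>x. f x - g x)"
proof (rule H_norm_le)
  fix x :: real assume x: "x \<in> {0..1}"
  have "\<bar>f x\<bar> \<le> \<bar>g x\<bar> + \<bar>f x - g x\<bar>" by simp
  also have "\<dots> \<le> H_norm g * x + H_norm (\<lambda>x. f x - g x) * x"
    by (intro add_mono in_H_le_H_norm in_H_diff assms x)
  finally show "\<bar>f x\<bar> \<le> (H_norm g + H_norm (\<lambda>x. f x - g x)) * x" by (simp add: algebra_simps)
qed

lemma C_H_in_H: "C_H T v \<Longrightarrow> t \<in> {0..T} \<Longrightarrow> in_H (v t)"
  by (simp add: C_H_def)

lemma C_H_diff:
  assumes v: "C_H T v" and u: "C_H T u"
  shows "C_H T (\<lambda>t x. v t x - u t x)"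
  unfolding C_H_def
proof (intro conjI ballI)
  fix t assume t: "t \<in> {0..T}"
  show "in_H (\<lambda>x. v t x - u t x)" by (intro in_H_diff C_H_in_H[OF v] C_H_in_H[OF u] t)
  show "((\<lambda>s. H_norm (\<lambda>x. v s x - u s x - (v t x - u t x))) \<longlongrightarrow> 0) (at t within {0..T})"
  proof (rule tendsto_sandwich[OF _ _ tendsto_const])
    have "0 \<le> H_norm (\<lambda>x. v s x - u s x - (v t x - u t x)) \<and>
        H_norm (\<lambda>x. v s x - u s x - (v t x - u t x))
        \<le> H_norm (\<lambda>x. v s x - v t x) + H_norm (\<lambda>x. u s x - u t x)" if s: "s \<in> {0..T}" for s
    proof
      show "0 \<le> H_norm (\<lambda>x. v s x - u s x - (v t x - u t x))"
        by (intro H_norm_nonneg in_H_diff C_H_in_H[OF v] C_H_in_H[OF u] s t)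
      show "H_norm (\<lambda>x. v s x - u s x - (v t x - u t x))
        \<le> H_norm (\<lambda>x. v s x - v t x) + H_norm (\<lambda>x. u s x - u t x)"
      proof (rule H_norm_le)
        fix x :: real assume x: "x \<in> {0..1}"
        have "\<bar>v s x - v t x\<bar> \<le> H_norm (\<lambda>x. v s x - v t x) * x"
          "\<bar>u s x - u t x\<bar> \<le> H_norm (\<lambda>x. u s x - u t x) * x"
          using in_H_le_H_norm[OF in_H_diff[OF C_H_in_H[OF v s] C_H_in_H[OF v t]] x]
            in_H_le_H_norm[OF in_H_diff[OF C_H_in_H[OF u s] C_H_in_H[OF u t]] x] by auto
        then show "\<bar>v s x - u s x - (v t x - u t x)\<bar>
            \<le> (H_norm (\<lambda>x. v s x - v t x) + H_norm (\<lambda>x. u s x - u t x)) * x"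
          unfolding distrib_right by linarith
      qed
    qed
    then show "\<forall>\<^sub>F s in at t within {0..T}. 0 \<le> H_norm (\<lambda>x. v s x - u s x - (v t x - u t x))"
      "\<forall>\<^sub>F s in at t within {0..T}. H_norm (\<lambda>x. v s x - u s x - (v t x - u t x))
        \<le> H_norm (\<lambda>x. v s x - v t x) + H_norm (\<lambda>x. u s x - u t x)"
      by (simp_all add: eventually_at_filter)
    have "((\<lambda>s. H_norm (\<lambda>x. v s x - v t x)) \<longlongrightarrow> 0) (at t within {0..T})"
      "((\<lambda>s. H_norm (\<lambda>x. u s x - u t x)) \<longlongrightarrow> 0) (at t within {0..T})"
      using u v t by (auto simp: C_H_def)
    from tendsto_add[OF this]
    show "((\<lambda>s. H_norm (\<lambda>x. v s x - v t x) + H_norm (\<lambda>x. u s x - u t x)) \<longlongrightarrow> 0) (at t within {0..T})"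
      by simp
  qed
qed

text \<open>Reverse triangle inequality. Continuity on the compact time interval bounds the norms of
  the slices, so that the outer supremum in \<open>H_normT\<close> is a genuine upper bound.\<close>

lemma continuous_on_H_norm:
  assumes v: "C_H T v"
  shows "continuous_on {0..T} (\<lambda>t. H_norm (v t))"
  unfolding continuous_on_def
proof
  fix t assume t: "t \<in> {0..T}"
  have "((\<lambda>s. H_norm (v s) - H_norm (v t)) \<longlongrightarrow> 0) (at t within {0..T})"
  proof (rule Lim_null_comparison)
    show "((\<lambda>s. H_norm (\<lambda>x. v s x - v t x)) \<longlongrightarrow> 0) (at t within {0..T})"
      using v t by (auto simp: C_H_def)
    have "\<bar>H_norm (v s) - H_norm (v t)\<bar> \<le> H_norm (\<lambda>x. v s x - v t x)" if s: "s \<in> {0..T}" for s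
    proof -
      have "H_norm (\<lambda>x. v t x - v s x) = H_norm (\<lambda>x. v s x - v t x)"
        unfolding H_norm_def by (simp add: abs_divide abs_minus_commute)
      then show ?thesis
        using H_norm_triangle[OF C_H_in_H[OF v s] C_H_in_H[OF v t]]
          H_norm_triangle[OF C_H_in_H[OF v t] C_H_in_H[OF v s]] by simp
    qed
    then show "\<forall>\<^sub>F s in at t within {0..T}. norm (H_norm (v s) - H_norm (v t))
        \<le> H_norm (\<lambda>x. v s x - v t x)"
      by (simp add: eventually_at_filter)
  qed
  then show "((\<lambda>s. H_norm (v s)) \<longlongrightarrow> H_norm (v t)) (at t within {0..T})"
    by (rule LIM_zero_cancel)
qed

lemma C_H_le_H_normT:
  assumes v: "C_H T v" and t: "t \<in> {0..T}" and x: "x \<in> {0..1}"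
  shows "\<bar>v t x\<bar> \<le> H_normT T v * x"
proof -
  have "bdd_above ((\<lambda>t. H_norm (v t)) ` {0..T})"
    by (intro bounded_imp_bdd_above compact_imp_bounded compact_continuous_image
        continuous_on_H_norm[OF v]) auto
  then have "H_norm (v t) \<le> H_normT T v"
    unfolding H_normT_def by (rule cSUP_upper[OF t])
  then have "H_norm (v t) * x \<le> H_normT T v * x" using x by (intro mult_right_mono) auto
  then show ?thesis using in_H_le_H_norm[OF C_H_in_H[OF v t] x] by simp
qed

lemma H_normT_nonneg:
  assumes "C_H T v" "T > 0" shows "0 \<le> H_normT T v"
  using C_H_le_H_normT[OF assms(1), of 0 1] assms(2) by simp

text \<open>The Heine-Cantor theorem for t \<mapsto> v(t) with values in the normed space, which is
  not a type here. A Lebesgue number of the cover by balls of continuity replaces the abstract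
  statement; \<epsilon> / 2 is spent twice, through the centre of a ball.\<close>

lemma C_H_uniformly_continuous:
  assumes v: "C_H T v" and "\<epsilon> > 0"
  obtains r where "r > 0" "\<And>s t x. s \<in> {0..T} \<Longrightarrow> t \<in> {0..T} \<Longrightarrow> \<bar>s - t\<bar> < r \<Longrightarrow> x \<in> {0..1} \<Longrightarrow>
    \<bar>v s x - v t x\<bar> \<le> \<epsilon> * x"
proof -
  have "\<exists>r>0. \<forall>s\<in>{0..T}. dist s t < r \<longrightarrow> (\<forall>x\<in>{0..1}. \<bar>v s x - v t x\<bar> \<le> \<epsilon> / 2 * x)"
    if t: "t \<in> {0..T}" for t
  proof -
    have "((\<lambda>s. H_norm (\<lambda>x. v s x - v t x)) \<longlongrightarrow> 0) (at t within {0..T})"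
      using v t by (simp add: C_H_def)
    then have "\<forall>\<^sub>F s in at t within {0..T}. H_norm (\<lambda>x. v s x - v t x) < \<epsilon> / 2"
      by (rule order_tendstoD) (use \<open>\<epsilon> > 0\<close> in simp)
    then obtain r where r: "r > 0" "\<And>s. s \<in> {0..T} \<Longrightarrow> s \<noteq> t \<Longrightarrow> dist s t < r \<Longrightarrow> H_norm (\<lambda>x. v s x - v t x) < \<epsilon> / 2"
      unfolding eventually_at by auto
    have "\<bar>v s x - v t x\<bar> \<le> \<epsilon> / 2 * x" if s: "s \<in> {0..T}" "dist s t < r" and x: "x \<in> {0..1}" for s x
    proof (cases "s = t")
      case True
      then show ?thesis using x \<open>\<epsilon> > 0\<close> by simp
    next
      case False
      have "\<bar>v s x - v t x\<bar> \<le> H_norm (\<lambda>x. v s x - v t x) * x"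
        by (rule in_H_le_H_norm[OF in_H_diff[OF C_H_in_H[OF v s(1)] C_H_in_H[OF v t]] x])
      also have "\<dots> \<le> \<epsilon> / 2 * x"
        using r(2)[OF s(1) False s(2)] x by (intro mult_right_mono) auto
      finally show ?thesis .
    qed
    then show ?thesis using r(1) by blast
  qed
  then obtain r where r: "\<And>t. t \<in> {0..T} \<Longrightarrow> r t > 0"
    "\<And>t s x. t \<in> {0..T} \<Longrightarrow> s \<in> {0..T} \<Longrightarrow> dist s t < r t \<Longrightarrow> x \<in> {0..1} \<Longrightarrow> \<bar>v s x - v t x\<bar> \<le> \<epsilon> / 2 * x"
    by metis
  obtain e where e: "e > 0" "\<And>t. t \<in> {0..T} \<Longrightarrow> \<exists>G\<in>(\<lambda>t. ball t (r t)) ` {0..T}. ball t e \<subseteq> G"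
  proof (rule Heine_Borel_lemma)
    show "compact {0..T}" by (rule compact_Icc)
    show "{0..T} \<subseteq> \<Union> ((\<lambda>t. ball t (r t)) ` {0..T})"
    proof
      fix t assume t: "t \<in> {0..T}"
      then have "t \<in> ball t (r t)" using r(1) by simp
      then show "t \<in> \<Union> ((\<lambda>t. ball t (r t)) ` {0..T})" using t by blast
    qed
  qed auto
  have "\<bar>v s x - v t x\<bar> \<le> \<epsilon> * x" if s: "s \<in> {0..T}" and t: "t \<in> {0..T}" and st: "\<bar>s - t\<bar> < e" and x: "x \<in> {0..1}" for s t x
  proof -
    obtain c where c: "c \<in> {0..T}" "ball t e \<subseteq> ball c (r c)" using e(2)[OF t] by auto
    have "t \<in> ball t e" "s \<in> ball t e" using e(1) st by (auto simp: dist_real_def)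
    then have "s \<in> ball c (r c)" "t \<in> ball c (r c)" using c(2) by blast+
    then have "dist s c < r c" "dist t c < r c" by (simp_all add: dist_commute)
    then have "\<bar>v s x - v c x\<bar> \<le> \<epsilon> / 2 * x" "\<bar>v t x - v c x\<bar> \<le> \<epsilon> / 2 * x"
      using r(2) c(1) s t x by auto
    then show ?thesis unfolding abs_le_iff by linarith
  qed
  then show ?thesis using that e(1) by blast
qed

section \<open>Linear bounds and time regularity of solutions\<close>

lemma obstacle_sol_nonneg:
  assumes sol: "obstacle_sol T z w \<eta>" and "t \<in> {0..T}" "x \<in> {0..1}"
  shows "0 \<le> w t x"
proof -
  \<comment> \<open>the zero function also solves the problem for the lowered obstacle\<close>
  have "obstacle_sol T (\<lambda>t x. min 0 (z t x)) (\<lambda>t x. 0) (null_measure borel)"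
    by (rule obstacle_sol_zero) simp
  from obstacle_sol_comparison[OF this sol, of 0 0 T 0 t x] show ?thesis
    using assms obstacle_solD(4)[OF sol] by simp
qed

text \<open>Comparison with the zero solution of the zero obstacle. The horizon S may be shorter
  than T, because a small slope C is available only on a short initial interval.\<close>

lemma obstacle_sol_le_linear:
  assumes sol: "obstacle_sol T z w \<eta>" and "S \<le> T" "C \<ge> 0"
    and "\<And>t x. t \<in> {0..S} \<Longrightarrow> x \<in> {0..1} \<Longrightarrow> z t x \<le> C * x"
    and "t \<in> {0..S}" "x \<in> {0..1}"
  shows "w t x \<le> C * x"
proof -
  have "obstacle_sol T (\<lambda>t x. 0) (\<lambda>t x. 0) (null_measure borel)"
    by (rule obstacle_sol_zero) simp
  from obstacle_sol_comparison[OF sol this, of 0 0 S C t x] show ?thesis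
    using assms obstacle_solD(4)[OF sol] by simp
qed

lemma obstacle_sol_uniformly_continuous:
  assumes sol: "obstacle_sol T z w \<eta>" and z: "C_H T z" and z0: "\<And>x. x \<in> {0..1} \<Longrightarrow> z 0 x \<le> 0"
    and "\<epsilon> > 0"
  obtains r where "r > 0" "\<And>s t x. s \<in> {0..T} \<Longrightarrow> t \<in> {0..T} \<Longrightarrow> \<bar>s - t\<bar> < r \<Longrightarrow> x \<in> {0..1} \<Longrightarrow>
    \<bar>w s x - w t x\<bar> \<le> \<epsilon> * x"
proof -
  obtain r where r: "r > 0" "\<And>s t x. s \<in> {0..T} \<Longrightarrow> t \<in> {0..T} \<Longrightarrow> \<bar>s - t\<bar> < r \<Longrightarrow> x \<in> {0..1} \<Longrightarrow>
    \<bar>z s x - z t x\<bar> \<le> \<epsilon> * x"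
    using C_H_uniformly_continuous[OF z \<open>\<epsilon> > 0\<close>] by blast
  have shift: "\<bar>w (t + h) x - w t x\<bar> \<le> \<epsilon> * x"
    if h: "0 \<le> h" "h < r" and t: "0 \<le> t" "t + h \<le> T" and x: "x \<in> {0..1}" for t h x
  proof -
    \<comment> \<open>The shifted solution starts from \<open>w h\<close> instead of 0. Since the
      obstacle is nonpositive at time 0, it is at most \<epsilon> x on \<open>{0..h}\<close>, and
      hence so is w; this settles the initial condition of both comparisons.\<close>
    have start: "w h x \<le> \<epsilon> * x" "0 \<le> w h x" if x: "x \<in> {0..1}" for x
    proof -
      show "w h x \<le> \<epsilon> * x"
      proof (rule obstacle_sol_le_linear[OF sol, of h])
        fix s x :: real assume "s \<in> {0..h}" "x \<in> {0..1}"
        then show "z s x \<le> \<epsilon> * x" using r(2)[of s 0 x] z0[of x] h t by (simp add: abs_le_iff)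
      qed (use h t x \<open>\<epsilon> > 0\<close> in auto)
      show "0 \<le> w h x" by (rule obstacle_sol_nonneg[OF sol]) (use h t x in auto)
    qed
    have zz: "z (h + s) x - z s x \<le> \<epsilon> * x" "z s x - z (h + s) x \<le> \<epsilon> * x"
      if "s \<in> {0..T - h}" "x \<in> {0..1}" for s x
      using r(2)[of "h + s" s x] that h by (auto simp: abs_le_iff)
    have "w (h + t) x - w (0 + t) x \<le> \<epsilon> * x"
    proof (rule obstacle_sol_comparison[OF sol sol, of h 0 "T - h"])
      fix s x :: real assume "s \<in> {0..T - h}" "x \<in> {0..1}"
      then show "z (h + s) x \<le> z (0 + s) x + \<epsilon> * x" using zz(1)[of s x] by simp
    qed (use h t x start obstacle_solD(4)[OF sol] \<open>\<epsilon> > 0\<close> in auto)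
    moreover have "w (0 + t) x - w (h + t) x \<le> \<epsilon> * x"
    proof (rule obstacle_sol_comparison[OF sol sol, of 0 h "T - h"])
      fix x :: real assume x: "x \<in> {0..1}"
      then have "0 \<le> \<epsilon> * x" using \<open>\<epsilon> > 0\<close> by simp
      then show "w 0 x - w h x \<le> \<epsilon> * x" using start(2)[OF x] obstacle_solD(4)[OF sol x] by linarith
    next
      fix s x :: real assume "s \<in> {0..T - h}" "x \<in> {0..1}"
      then show "z (0 + s) x \<le> z (h + s) x + \<epsilon> * x" using zz(2)[of s x] by simp
    qed (use h t x \<open>\<epsilon> > 0\<close> in auto)
    ultimately show ?thesis by (simp add: abs_le_iff add.commute)
  qed
  have "\<bar>w s x - w t x\<bar> \<le> \<epsilon> * x"
    if "s \<in> {0..T}" "t \<in> {0..T}" "\<bar>s - t\<bar> < r" "x \<in> {0..1}" for s t x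
    using shift[of "s - t" t x] shift[of "t - s" s x] that
    by (cases "t \<le> s") (auto simp: abs_minus_commute)
  then show ?thesis using that r(1) by blast
qed

section \<open>Differentiability in space at the left endpoint\<close>

text \<open>The mollified A, less B y^2 / 2, has a nonpositive classical second derivative on
  \<open>{\<delta><..<1 - \<delta>}\<close>. A concavity inequality involves only three points, so
  it survives the pointwise limit \<delta> \<rightarrow> 0, in which these intervals exhaust the
  open unit interval.\<close>

lemma concave_on_of_weak_deriv2_le:
  fixes A :: "real \<Rightarrow> real"
  assumes A: "continuous_on {0..1} A"
    and weak: "\<And>\<delta> y. \<delta> > 0 \<Longrightarrow> \<delta> < y \<Longrightarrow> y < 1 - \<delta> \<Longrightarrow>
      integral {0..1} (\<lambda>x. A x * bump'' \<delta> (x - y)) \<le> B"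
  shows "concave_on {0<..<1} (\<lambda>x. A x - B / 2 * x\<^sup>2)"
proof -
  define M where "M \<delta> y = integral {0..1} (\<lambda>x. A x * bump \<delta> (x - y)) - B / 2 * y\<^sup>2" for \<delta> y
  have conc: "concave_on {\<delta><..<1 - \<delta>} (M \<delta>)" if "\<delta> > 0" for \<delta>
  proof (rule f''_le0_imp_concave)
    fix y assume y: "y \<in> {\<delta><..<1 - \<delta>}"
    show "(M \<delta> has_real_derivative - integral {0..1} (\<lambda>x. A x * bump' \<delta> (x - y)) - B * y) (at y)"
      unfolding M_def by (rule derivative_eq_intros mollify_deriv[OF A] refl | simp)+
    show "((\<lambda>y. - integral {0..1} (\<lambda>x. A x * bump' \<delta> (x - y)) - B * y) has_real_derivative
        integral {0..1} (\<lambda>x. A x * bump'' \<delta> (x - y)) - B) (at y)"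
      by (rule DERIV_diff[OF mollify_deriv2[OF A]]) (auto intro!: derivative_eq_intros)
    show "integral {0..1} (\<lambda>x. A x * bump'' \<delta> (x - y)) - B \<le> 0"
      using weak[OF that, of y] y by simp
  qed auto
  have lim: "((\<lambda>\<delta>. M \<delta> y) \<longlongrightarrow> A y - B / 2 * y\<^sup>2) (at_right 0)" if y: "y \<in> {0<..<1}" for y
    unfolding M_def
  proof (intro tendsto_diff tendsto_const, rule tendstoI)
    fix e :: real assume "e > 0"
    then obtain d where d: "d > 0" "\<And>x. x \<in> {0..1} \<Longrightarrow> dist x y < d \<Longrightarrow> dist (A x) (A y) < e / 2"
      using A y unfolding continuous_on_iff
      by (metis atLeastAtMost_iff greaterThanLessThan_iff half_gt_zero less_le)
    have "\<forall>\<^sub>F \<delta> in at_right 0. \<delta> \<in> {0<..<min d (min y (1 - y))}"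
      by (rule eventually_at_rightI[where b = "min d (min y (1 - y))"]) (use d y in auto)
    then show "\<forall>\<^sub>F \<delta> in at_right 0. dist (integral {0..1} (\<lambda>x. A x * bump \<delta> (x - y))) (A y) < e"
    proof eventually_elim
      case (elim \<delta>)
      have "\<bar>integral {0..1} (\<lambda>x. A x * bump \<delta> (x - y)) - A y\<bar> \<le> e / 2"
      proof (rule mollify_approx[OF A])
        fix x assume x: "x \<in> {y - \<delta>..y + \<delta>}"
        have "dist (A x) (A y) < e / 2" by (rule d(2)) (use x elim in \<open>auto simp: dist_real_def\<close>)
        then show "\<bar>A x - A y\<bar> \<le> e / 2" by (simp add: dist_real_def)
      qed (use elim in auto)
      then show ?case using \<open>e > 0\<close> by (simp add: dist_real_def)
    qed
  qed
  show ?thesis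
    unfolding concave_on_iff
  proof (intro conjI ballI allI impI)
    fix x y u v :: real
    assume x: "x \<in> {0<..<1}" and y: "y \<in> {0<..<1}" and uv: "u \<ge> 0" "v \<ge> 0" "u + v = 1"
    have xy: "u *\<^sub>R x + v *\<^sub>R y \<in> {0<..<1}"
      using convexD[OF convex_real_interval(8) x y uv] .
    have "u * (A x - B / 2 * x\<^sup>2) + v * (A y - B / 2 * y\<^sup>2)
        \<le> A (u *\<^sub>R x + v *\<^sub>R y) - B / 2 * (u *\<^sub>R x + v *\<^sub>R y)\<^sup>2"
    proof (rule tendsto_le[OF _ lim[OF xy]])
      show "((\<lambda>\<delta>. u * M \<delta> x + v * M \<delta> y) \<longlongrightarrow>
          u * (A x - B / 2 * x\<^sup>2) + v * (A y - B / 2 * y\<^sup>2)) (at_right 0)"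
        by (intro tendsto_intros lim x y)
      have "\<forall>\<^sub>F \<delta> in at_right 0. \<delta> \<in> {0<..<min (min x (1 - x)) (min y (1 - y))}"
        by (rule eventually_at_rightI[where b = "min (min x (1 - x)) (min y (1 - y))"]) (use x y in auto)
      then show "\<forall>\<^sub>F \<delta> in at_right 0. u * M \<delta> x + v * M \<delta> y \<le> M \<delta> (u *\<^sub>R x + v *\<^sub>R y)"
      proof eventually_elim
        case (elim \<delta>)
        then show ?case using conc[of \<delta>] uv unfolding concave_on_iff by auto
      qed
    qed simp
    then show "u * (A x - B / 2 * x\<^sup>2) + v * (A y - B / 2 * y\<^sup>2)
        \<le> A (u *\<^sub>R x + v *\<^sub>R y) - B / 2 * (u *\<^sub>R x + v *\<^sub>R y)\<^sup>2" .
  qed auto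
qed

text \<open>F(x) / x is the slope of the chord from the origin. Concavity is available only on the
  open interval, so the chord starts at p > 0, and continuity of F lets p tend to 0.\<close>

lemma concave_on_quotient_antimono:
  fixes F :: "real \<Rightarrow> real"
  assumes conc: "concave_on {0<..<1} F" and F: "continuous_on {0..1} F" "F 0 = 0"
    and xy: "0 < x" "x < y" "y < 1"
  shows "F y / y \<le> F x / x"
proof -
  have lim: "(F \<longlongrightarrow> 0) (at_right 0)"
    using F at_within_Icc_at_right[of 0 "1::real"] unfolding continuous_on_def by force
  have "((\<lambda>p. (y - x) * F p + (x - p) * F y) \<longlongrightarrow> (y - x) * 0 + (x - 0) * F y) (at_right 0)"
    by (intro tendsto_intros lim)
  moreover have "((\<lambda>p. (y - p) * F x) \<longlongrightarrow> (y - 0) * F x) (at_right 0)"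
    by (intro tendsto_intros)
  moreover have "\<forall>\<^sub>F p in at_right 0. p \<in> {0<..<x}"
    by (rule eventually_at_rightI[where b = x]) (use xy in auto)
  then have "\<forall>\<^sub>F p in at_right 0. (y - x) * F p + (x - p) * F y \<le> (y - p) * F x"
  proof eventually_elim
    case (elim p)
    \<comment> \<open>The weights that express x as the convex combination u p + v y.\<close>
    define u where "u = (y - x) / (y - p)"
    define v where "v = (x - p) / (y - p)"
    have "y - p > 0" using elim xy by auto
    have "u + v = (y - p) / (y - p)" unfolding u_def v_def add_divide_distrib[symmetric] by simp
    then have uv: "u \<ge> 0" "v \<ge> 0" "u + v = 1" using elim xy by (auto simp: u_def v_def)
    have "u * p + v * y = ((y - x) * p + (x - p) * y) / (y - p)"
      by (simp add: u_def v_def add_divide_distrib)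
    also have "(y - x) * p + (x - p) * y = x * (y - p)" by (simp add: algebra_simps)
    finally have "u * p + v * y = x" using \<open>y - p > 0\<close> by simp
    then have "u * F p + v * F y \<le> F x"
      using conc uv elim xy unfolding concave_on_iff by (metis greaterThanLessThan_iff less_trans real_scaleR_def)
    then have "(y - p) * (u * F p + v * F y) \<le> (y - p) * F x"
      using elim xy by (intro mult_left_mono) auto
    moreover have "(y - p) * u = y - x" "(y - p) * v = x - p" using elim xy by (auto simp: u_def v_def)
    ultimately show ?case by (simp add: distrib_left mult.assoc[symmetric])
  qed
  ultimately have "(y - x) * 0 + (x - 0) * F y \<le> (y - 0) * F x"
    by (intro tendsto_le[of "at_right (0::real)"]) auto
  then show ?thesis using xy by (simp add: field_simps)
qed

text \<open>Convergence of bounded monotone functions, with a defect. Along some sequence tending to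
  0 the values converge to a number L; a small y lies between two of its members, and
  \<open>anti\<close> applied on either side squeezes u(y) around L. The constant C may depend on
  \<epsilon>, since it is multiplied by a point that tends to 0.\<close>

lemma almost_antimono_tendsto:
  fixes u :: "real \<Rightarrow> real"
  assumes bdd: "\<And>x. x \<in> {0<..<1} \<Longrightarrow> \<bar>u x\<bar> \<le> K"
    and anti: "\<And>\<epsilon>. \<epsilon> > 0 \<Longrightarrow> \<exists>C\<ge>0. \<forall>x y. 0 < x \<longrightarrow> x < y \<longrightarrow> y < 1 \<longrightarrow> u y \<le> u x + \<epsilon> + C * y"
  shows "\<exists>L. (u \<longlongrightarrow> L) (at_right 0)"
proof -
  \<comment> \<open>Starting at 1 / 2 keeps every point inside the open unit interval.\<close>
  define X where "X n = inverse (real (Suc (Suc n)))" for n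
  have X: "X n \<in> {0<..<1}" for n by (auto simp: X_def field_simps)
  have "X \<longlonglongrightarrow> 0" unfolding X_def
    by (intro LIMSEQ_Suc[where f = "\<lambda>n. inverse (real (Suc n))"] LIMSEQ_inverse_real_of_nat)
  have "\<forall>n. u (X n) \<in> {-K..K}" using bdd[OF X] by (auto simp: abs_le_iff minus_le_iff)
  then obtain L r where r: "strict_mono r" "((\<lambda>n. u (X n)) \<circ> r) \<longlonglongrightarrow> L"
    using compact_Icc[of "-K" K] unfolding compact_eq_seq_compact_metric seq_compact_def by metis
  have Xr: "(\<lambda>n. X (r n)) \<longlonglongrightarrow> 0"
    using LIMSEQ_subseq_LIMSEQ[OF \<open>X \<longlonglongrightarrow> 0\<close> r(1)] by (simp add: o_def)
  have ur: "(\<lambda>n. u (X (r n))) \<longlonglongrightarrow> L" using r(2) by (simp add: o_def)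
  have "(u \<longlongrightarrow> L) (at_right 0)"
  proof (rule tendstoI)
    fix e :: real assume e: "e > 0"
    obtain C where C: "C \<ge> 0" "\<And>x y. 0 < x \<Longrightarrow> x < y \<Longrightarrow> y < 1 \<Longrightarrow> u y \<le> u x + e / 4 + C * y"
      using anti[of "e / 4"] e by auto
    \<comment> \<open>Makes C y \<le> e / 4 below d, where C + 1 covers C = 0; three errors of e / 4
      then stay below e.\<close>
    define d where "d = e / (4 * (C + 1))"
    have d: "d > 0" using e C by (simp add: d_def)
    have Cd: "C * y \<le> e / 4" if "0 < y" "y < d" for y
    proof -
      have "C * y \<le> (C + 1) * d" using that C(1) by (intro mult_mono) auto
      also have "\<dots> = e / 4" using C(1) by (simp add: d_def field_simps)
      finally show ?thesis .
    qed
    have close: "\<forall>\<^sub>F n in sequentially. dist (u (X (r n))) L < e / 4"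
      using tendstoD[OF ur, of "e / 4"] e by simp
    have "\<forall>\<^sub>F n in sequentially. X (r n) < d" by (rule order_tendstoD(2)[OF Xr d])
    then have "\<forall>\<^sub>F n in sequentially. X (r n) < d \<and> dist (u (X (r n))) L < e / 4"
      using close by eventually_elim simp
    then obtain N where N: "X (r N) < d" "dist (u (X (r N))) L < e / 4"
      by (auto simp: eventually_sequentially)
    have "\<forall>\<^sub>F y in at_right 0. y \<in> {0<..<X (r N)}"
      by (rule eventually_at_rightI[where b = "X (r N)"]) (use X[of "r N"] in auto)
    then show "\<forall>\<^sub>F y in at_right 0. dist (u y) L < e"
    proof eventually_elim
      case (elim y)
      have "\<forall>\<^sub>F n in sequentially. X (r n) < y" by (rule order_tendstoD(2)[OF Xr]) (use elim in auto)
      then have "\<forall>\<^sub>F n in sequentially. X (r n) < y \<and> dist (u (X (r n))) L < e / 4"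
        using close by eventually_elim simp
      then obtain n where n: "X (r n) < y" "dist (u (X (r n))) L < e / 4"
        by (auto simp: eventually_sequentially)
      have "u y \<le> u (X (r n)) + e / 4 + C * y"
        using C(2)[of "X (r n)" y] n X[of "r n"] X[of "r N"] elim by auto
      moreover have "u (X (r N)) \<le> u y + e / 4 + C * X (r N)"
        using C(2)[of y "X (r N)"] X[of "r N"] elim by auto
      moreover have "C * y \<le> e / 4" "C * X (r N) \<le> e / 4" using Cd N X[of "r N"] elim by auto
      ultimately show ?case using n(2) N(2) e unfolding dist_real_def by linarith
    qed
  qed
  then show ?thesis ..
qed

lemma obstacle_sol_in_H:
  assumes sol: "obstacle_sol T z w \<eta>" and z: "C_H T z" and z0: "\<And>x. x \<in> {0..1} \<Longrightarrow> z 0 x \<le> 0"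
    and "T > 0" and t: "t \<in> {0..T}"
  shows "in_H (w t)"
proof -
  define K where "K = H_normT T z"
  have K: "K \<ge> 0" unfolding K_def by (rule H_normT_nonneg[OF z \<open>T > 0\<close>])
  have wK: "w s x \<le> K * x" "0 \<le> w s x" if "s \<in> {0..T}" "x \<in> {0..1}" for s x
  proof -
    show "w s x \<le> K * x"
    proof (rule obstacle_sol_le_linear[OF sol order_refl K _ that])
      fix s x :: real assume "s \<in> {0..T}" "x \<in> {0..1}"
      then show "z s x \<le> K * x" using C_H_le_H_normT[OF z, of s x] by (simp add: K_def)
    qed
    show "0 \<le> w s x" by (rule obstacle_sol_nonneg[OF sol that])
  qed
  have anti: "\<exists>C\<ge>0. \<forall>x y. 0 < x \<longrightarrow> x < y \<longrightarrow> y < 1 \<longrightarrow> w t y / y \<le> w t x / x + e + C * y"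
    if e: "e > 0" and "t > 0" for e
  proof -
    obtain r where r: "r > 0" "\<And>s t x. s \<in> {0..T} \<Longrightarrow> t \<in> {0..T} \<Longrightarrow> \<bar>s - t\<bar> < r \<Longrightarrow> x \<in> {0..1} \<Longrightarrow>
        \<bar>w s x - w t x\<bar> \<le> e / 2 * x"
      using obstacle_sol_uniformly_continuous[OF sol z z0, of "e / 2"] e by (metis half_gt_zero)
    \<comment> \<open>The averaging window from a to t is nonempty because t > 0, and short enough
      for w(s, x) / x to differ from w(t, x) / x by at most e / 2 on it.\<close>
    define a where "a = max 0 (t - r / 2)"
    have a: "0 \<le> a" "a < t" "t - a < r" using r(1) \<open>t > 0\<close> by (auto simp: a_def)
    define A where "A x = integral {a..t} (\<lambda>s. w s x)" for x
    have cont: "continuous_on ({0..1} \<times> {a..t}) (\<lambda>(x,s). w s x)"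
    proof -
      have "continuous_on ({0..1} \<times> {a..t}) (\<lambda>p. (\<lambda>(t,x). w t x) (snd p, fst p))"
        by (rule continuous_on_compose2[OF obstacle_solD(1)[OF sol]])
           (use a t in \<open>auto intro!: continuous_intros\<close>)
      then show ?thesis by (simp add: case_prod_beta)
    qed
    have contA: "continuous_on {0..1} A"
      unfolding A_def using integral_continuous_on_param[of "{0..1}" a t "\<lambda>x s. w s x"] cont by simp
    have intw: "(\<lambda>s. w s x) integrable_on {a..t}" if "x \<in> {0..1}" for x
    proof -
      have "continuous_on {a..t} (\<lambda>s. (\<lambda>(x,s). w s x) (x, s))"
        by (rule continuous_on_compose2[OF cont]) (use that in \<open>auto intro!: continuous_intros\<close>)
      then show ?thesis by (intro integrable_continuous_interval) simp
    qed
    \<comment> \<open>Integration over the window turns the lower bound for increments into an upper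
      bound for the weak second derivative of A: the mollified increment of w from a to t is at most
      K, since 0 \<le> w \<le> K. The bound does not depend on the window.\<close>
    have weak: "integral {0..1} (\<lambda>x. A x * bump'' \<delta> (x - y)) \<le> K"
      if \<delta>: "\<delta> > 0" "\<delta> < y" "y < 1 - \<delta>" for \<delta> y
    proof -
      have "integral {0..1} (\<lambda>x. A x * bump'' \<delta> (x - y))
          = integral {0..1} (\<lambda>x. integral {a..t} (\<lambda>s. w s x * bump'' \<delta> (x - y)))"
        unfolding A_def by simp
      also have "\<dots> = integral {a..t} (\<lambda>s. integral {0..1} (\<lambda>x. w s x * bump'' \<delta> (x - y)))"
      proof -
        have "continuous_on ({0..1} \<times> {a..t}) (\<lambda>(x,s). w s x * bump'' \<delta> (x - y))"
          using cont by (auto simp: case_prod_beta intro!: continuous_intros)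
        then show ?thesis
          using integral_swap_continuous[of 0 a 1 t "\<lambda>x s. w s x * bump'' \<delta> (x - y)"]
          by (simp add: cbox_Pair_eq)
      qed
      also have "\<dots> \<le> integral {0..1} (\<lambda>x. w t x * bump \<delta> (x - y)) - integral {0..1} (\<lambda>x. w a x * bump \<delta> (x - y))"
        by (rule obstacle_sol_increment_ge[OF sol \<delta>]) (use a t in auto)
      also have "\<dots> \<le> K - 0"
      proof (rule diff_mono)
        show "integral {0..1} (\<lambda>x. w t x * bump \<delta> (x - y)) \<le> K"
        proof (rule mollify_le[OF obstacle_sol_continuous_slice[OF sol t] \<delta>(1)])
          fix x assume "x \<in> {y - \<delta>..y + \<delta>}"
          then have x: "x \<in> {0..1}" using \<delta> by auto
          then have "K * x \<le> K * 1" using K by (intro mult_left_mono) auto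
          then show "w t x \<le> K" using wK(1)[OF t x] by simp
        qed (use \<delta> in auto)
        show "0 \<le> integral {0..1} (\<lambda>x. w a x * bump \<delta> (x - y))"
          by (intro integral_nonneg integrable_bump obstacle_sol_continuous_slice[OF sol]
              mult_nonneg_nonneg bump_nonneg wK(2) \<delta>(1)) (use a t in auto)
      qed
      finally show ?thesis by simp
    qed
    define F where "F x = A x - K / 2 * x\<^sup>2" for x
    have quot: "F y / y \<le> F x / x" if "0 < x" "x < y" "y < 1" for x y
    proof (rule concave_on_quotient_antimono[OF _ _ _ that])
      show "concave_on {0<..<1} F" unfolding F_def by (rule concave_on_of_weak_deriv2_le[OF contA weak])
      show "continuous_on {0..1} F" unfolding F_def by (intro continuous_intros contA)
      have "A 0 = integral {a..t} (\<lambda>s. 0)"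
        unfolding A_def by (rule integral_cong) (use obstacle_solD(2)[OF sol] a t in auto)
      then show "F 0 = 0" by (simp add: F_def)
    qed
    have near: "\<bar>A x - (t - a) * w t x\<bar> \<le> (t - a) * (e / 2 * x)" if x: "x \<in> {0..1}" for x
    proof -
      have "A x \<le> integral {a..t} (\<lambda>s. w t x + e / 2 * x)"
        unfolding A_def
      proof (rule integral_le[OF intw[OF x]])
        fix s assume "s \<in> {a..t}"
        then have "\<bar>w s x - w t x\<bar> \<le> e / 2 * x" using a t x by (intro r(2)) auto
        then show "w s x \<le> w t x + e / 2 * x" unfolding abs_le_iff by linarith
      qed auto
      moreover have "integral {a..t} (\<lambda>s. w t x - e / 2 * x) \<le> A x"
        unfolding A_def
      proof (rule integral_le[OF _ intw[OF x]])
        fix s assume "s \<in> {a..t}"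
        then have "\<bar>w s x - w t x\<bar> \<le> e / 2 * x" using a t x by (intro r(2)) auto
        then show "w t x - e / 2 * x \<le> w s x" unfolding abs_le_iff by linarith
      qed auto
      ultimately have "A x \<le> (t - a) * (w t x + e / 2 * x)" "(t - a) * (w t x - e / 2 * x) \<le> A x"
        using a by simp_all
      then show ?thesis unfolding abs_le_iff distrib_left right_diff_distrib by linarith
    qed
    \<comment> \<open>Division by the window length gives C = K / (2 (t - a)), which may blow up as
      e \<rightarrow> 0; \<open>almost_antimono_tendsto\<close> allows for that. The error e is e /
      2 from each of the points x and y, where A is replaced by (t - a) w(t).\<close>
    have "w t y / y \<le> w t x / x + e + K / (2 * (t - a)) * y" if xy: "0 < x" "x < y" "y < 1" for x y
    proof -
      have "A y / y - K / 2 * y \<le> A x / x - K / 2 * x"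
        using quot[OF xy] xy by (simp add: F_def diff_divide_distrib power2_eq_square)
      moreover have "K / 2 * x \<ge> 0" using K xy by simp
      moreover have "(t - a) * (w t y / y) - (t - a) * (e / 2) \<le> A y / y"
      proof -
        have "(t - a) * w t y - (t - a) * (e / 2 * y) \<le> A y"
          using near[of y] xy unfolding abs_le_iff by auto
        then have "((t - a) * w t y - (t - a) * (e / 2 * y)) / y \<le> A y / y"
          using xy by (intro divide_right_mono) auto
        then show ?thesis using xy by (simp add: diff_divide_distrib)
      qed
      moreover have "A x / x \<le> (t - a) * (w t x / x) + (t - a) * (e / 2)"
      proof -
        have "A x \<le> (t - a) * w t x + (t - a) * (e / 2 * x)"
          using near[of x] xy unfolding abs_le_iff by auto
        then have "A x / x \<le> ((t - a) * w t x + (t - a) * (e / 2 * x)) / x"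
          using xy by (intro divide_right_mono) auto
        then show ?thesis using xy by (simp add: add_divide_distrib)
      qed
      ultimately have "(t - a) * (w t y / y) \<le> (t - a) * (w t x / x) + (t - a) * e + K / 2 * y"
        by simp
      also have "\<dots> = (t - a) * (w t x / x + e + K / (2 * (t - a)) * y)"
        using a by (simp add: field_simps)
      finally show ?thesis by (rule mult_left_le_imp_le) (use a in simp)
    qed
    moreover have "K / (2 * (t - a)) \<ge> 0" using K a by simp
    ultimately show ?thesis by blast
  qed
  have "\<exists>L. ((\<lambda>x. w t x / x) \<longlongrightarrow> L) (at_right 0)"
  \<comment> \<open>At time 0 no window precedes, but there w vanishes identically.\<close>
  proof (cases "t = 0")
    case True
    have "\<forall>\<^sub>F x in at_right 0. x \<in> {0<..<1::real}" by (rule eventually_at_rightI[of 0 1]) auto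
    then have "\<forall>\<^sub>F x in at_right 0. 0 = w t x / x"
      by eventually_elim (use obstacle_solD(4)[OF sol] True in auto)
    from Lim_transform_eventually[OF tendsto_const this] show ?thesis by blast
  next
    case False
    then have "t > 0" using t by simp
    show ?thesis
    proof (rule almost_antimono_tendsto[OF _ anti[OF _ \<open>t > 0\<close>]])
      fix x :: real assume "x \<in> {0<..<1}"
      then show "\<bar>w t x / x\<bar> \<le> K" using wK[OF t, of x] by (simp add: abs_divide field_simps)
    qed
  qed
  then obtain L where "((\<lambda>x. w t x / x) \<longlongrightarrow> L) (at_right 0)" ..
  then have "(w t has_real_derivative L) (at 0 within {0..1})"
    using obstacle_solD(2)[OF sol t] by (simp add: has_field_derivative_iff at_within_Icc_at_right)
  then show ?thesis
    using obstacle_sol_continuous_slice[OF sol t] obstacle_solD(2,3)[OF sol t]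
    unfolding in_H_def real_differentiable_def by blast
qed

lemma obstacle_sol_C_H:
  assumes sol: "obstacle_sol T z w \<eta>" and z: "C_H T z" and z0: "\<And>x. x \<in> {0..1} \<Longrightarrow> z 0 x \<le> 0"
    and "T > 0"
  shows "C_H T w"
proof -
  note H = obstacle_sol_in_H[OF sol z z0 \<open>T > 0\<close>]
  have "((\<lambda>s. H_norm (\<lambda>x. w s x - w t x)) \<longlongrightarrow> 0) (at t within {0..T})" if t: "t \<in> {0..T}" for t
  proof (rule tendstoI)
    fix e :: real assume e: "e > 0"
    obtain r where r: "r > 0" "\<And>s t x. s \<in> {0..T} \<Longrightarrow> t \<in> {0..T} \<Longrightarrow> \<bar>s - t\<bar> < r \<Longrightarrow> x \<in> {0..1} \<Longrightarrow>
        \<bar>w s x - w t x\<bar> \<le> e / 2 * x"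
      using obstacle_sol_uniformly_continuous[OF sol z z0, of "e / 2"] e by (metis half_gt_zero)
    have "dist (H_norm (\<lambda>x. w s x - w t x)) 0 < e" if s: "s \<in> {0..T}" "dist s t < r" for s
    proof -
      have "H_norm (\<lambda>x. w s x - w t x) \<le> e / 2"
        by (rule H_norm_le) (use r(2) s t in \<open>auto simp: dist_real_def\<close>)
      moreover have "0 \<le> H_norm (\<lambda>x. w s x - w t x)"
        by (intro H_norm_nonneg in_H_diff H s t)
      ultimately show ?thesis using e by (simp add: dist_real_def)
    qed
    then show "\<forall>\<^sub>F s in at t within {0..T}. dist (H_norm (\<lambda>x. w s x - w t x)) 0 < e"
      unfolding eventually_at using r(1) by auto
  qed
  then show ?thesis unfolding C_H_def using H by blast
qed

theorem theorem3p2: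
  fixes T :: real and z1 z2 w1 w2 :: "real \<Rightarrow> real \<Rightarrow> real"
    and \<eta>1 \<eta>2 :: "(real \<times> real) measure"
  assumes "T > 0"
    and "C_H T z1" and "C_H T z2"
    and "\<forall>x\<in>{0..1}. z1 0 x \<le> 0" and "\<forall>x\<in>{0..1}. z2 0 x \<le> 0"
    and "obstacle_sol T z1 w1 \<eta>1" and "obstacle_sol T z2 w2 \<eta>2"
  shows "C_H T w1 \<and> C_H T w2 \<and>
         H_normT T (\<lambda>t x. w1 t x - w2 t x) \<le> H_normT T (\<lambda>t x. z1 t x - z2 t x)"
proof (intro conjI)
  note sol1 = \<open>obstacle_sol T z1 w1 \<eta>1\<close> and sol2 = \<open>obstacle_sol T z2 w2 \<eta>2\<close>
  show "C_H T w1" by (rule obstacle_sol_C_H[OF sol1 assms(2) _ assms(1)]) (use assms(4) in blast)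
  show "C_H T w2" by (rule obstacle_sol_C_H[OF sol2 assms(3) _ assms(1)]) (use assms(5) in blast)
  let ?K = "H_normT T (\<lambda>t x. z1 t x - z2 t x)"
  note z = C_H_diff[OF assms(2,3)]
  have K: "?K \<ge> 0" by (rule H_normT_nonneg[OF z assms(1)])
  have le: "z1 t x \<le> z2 t x + ?K * x" "z2 t x \<le> z1 t x + ?K * x" if "t \<in> {0..T}" "x \<in> {0..1}" for t x
    using C_H_le_H_normT[OF z that] by (auto simp: abs_le_iff)
  show "H_normT T (\<lambda>t x. w1 t x - w2 t x) \<le> ?K"
    unfolding H_normT_def[of T "\<lambda>t x. w1 t x - w2 t x"]
  proof (intro cSUP_least H_norm_le)
    fix t x :: real assume t: "t \<in> {0..T}" and x: "x \<in> {0..1}"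
    \<comment> \<open>Both offsets are 0; writing 0 + t lets the goal unify with the shifted form.
      The norm \<open>?K\<close> itself serves as the slope C, and exchanging the solutions gives
      the other sign.\<close>
    have "w1 (0 + t) x - w2 (0 + t) x \<le> ?K * x"
      by (rule obstacle_sol_comparison[OF sol1 sol2 _ _ _ _ K _ _ t x])
         (use le obstacle_solD(4)[OF sol1] obstacle_solD(4)[OF sol2] K in auto)
    moreover have "w2 (0 + t) x - w1 (0 + t) x \<le> ?K * x"
      by (rule obstacle_sol_comparison[OF sol2 sol1 _ _ _ _ K _ _ t x])
         (use le obstacle_solD(4)[OF sol1] obstacle_solD(4)[OF sol2] K in auto)
    ultimately show "\<bar>w1 t x - w2 t x\<bar> \<le> ?K * x" by (simp add: abs_le_iff)
  qed (use assms(1) in auto)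
qed

end
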